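(* Let $q$ be a prime power, let $\lambda \in \mathbb{F}_{q^n}\setminus\mathbb{F}_q$, $t = [\mathbb{F}_q(\lambda):\mathbb{F}_q]$, let $\overline{S}$ be an $\mathbb{F}_{q^t}$-subspace of $\mathbb{F}_{q^n}$ of $\mathbb{F}_{q^t}$-dimension $l>0$, $b \in \mathbb{F}_{q^n}^*$ with $\mathbb{F}_{q^t}\cap b\overline{S}=\{0\}$, $0<m<t$, $k = tl+m$ with $t+1 \le k \le n$, and $S = \overline{S} \oplus b\langle 1, \lambda, \ldots, \lambda^{m-1}\rangle_{\mathbb{F}_q}$, with $Y=\langle S\rangle_{\mathbb{F}_{q^t}} = \mathbb{F}_{q^n}$ and $2m > t$. Suppose $\mathcal{C}=\mathrm{Orb}(S)$ is an $r$-FWS code with $r = 2m+t(l-1)$. Then \[ \omega_{2i}(\mathcal{C}) = \begin{cases} (q + 1)q^{2i-1}, & \text{if } i \in \{1, \ldots, t - m - 1\}, \\ \frac{q^n - q^{2(t-m)-1}}{q - 1}, & \text{if } i = t - m. \end{cases} \]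
   Context: $\mathrm{Orb}(S)=\{\alpha S:\alpha\in\mathbb{F}_{q^n}^*\}$; $d(U,V)=2k-2\dim_{\mathbb{F}_q}(U\cap V)$; the weight distribution is $\omega_{2i}(\mathcal{C})=|\{\alpha S: \alpha\in\mathbb{F}_{q^n}^*, d(S,\alpha S)=2i\}|$ for $i=1,\dots,k$. $\mathcal{C}$ is an $r$-FWS code if $\omega_{2i}=0$ for $i=k-r+1,\ldots,k$ and $\omega_{2i}\neq 0$ for all $i=1,\ldots,k-r$. $\langle S\rangle_{\mathbb{F}_{q^t}}$ denotes the $\mathbb{F}_{q^t}$-span of $S$. *)

theory Defs
  imports "HOL-Computational_Algebra.Primes" "HOL-Algebra.Algebra"
begin

(* The subfield of a finite field R fixed by x |-> x^e; for R = F_{q^n} and e = q^s with s | n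
   this is the unique subfield F_{q^s}. *)
definition Fsub :: "('a, 'b) ring_scheme \<Rightarrow> nat \<Rightarrow> 'a set" where
  "Fsub R e = {x \<in> carrier R. x [^]\<^bsub>R\<^esub> e = x}"

definition smul_set :: "('a, 'b) ring_scheme \<Rightarrow> 'a \<Rightarrow> 'a set \<Rightarrow> 'a set" where
  "smul_set R \<alpha> S = (\<lambda>x. \<alpha> \<otimes>\<^bsub>R\<^esub> x) ` S"

definition orb :: "('a, 'b) ring_scheme \<Rightarrow> 'a set \<Rightarrow> 'a set set" where
  "orb R S = {smul_set R \<alpha> S | \<alpha>. \<alpha> \<in> carrier R - {\<zero>\<^bsub>R\<^esub>}}"

(* subspace distance d(U,V) = 2k - 2 dim_K (U \<inter> V) between k-dimensional K-subspaces *)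
definition sdist :: "('a, 'b) ring_scheme \<Rightarrow> 'a set \<Rightarrow> nat \<Rightarrow> 'a set \<Rightarrow> 'a set \<Rightarrow> nat" where
  "sdist R K k U V = 2 * k - 2 * ring.dim R K (U \<inter> V)"

definition weight :: "('a, 'b) ring_scheme \<Rightarrow> 'a set \<Rightarrow> nat \<Rightarrow> 'a set \<Rightarrow> nat \<Rightarrow> nat" where
  "weight R K k S i = card {V \<in> orb R S. sdist R K k S V = 2 * i}"

definition is_FWS :: "('a, 'b) ring_scheme \<Rightarrow> 'a set \<Rightarrow> nat \<Rightarrow> 'a set \<Rightarrow> nat \<Rightarrow> bool" where
  "is_FWS R K k S r \<longleftrightarrow>
     (\<forall>i \<in> {k - r + 1..k}. weight R K k S i = 0) \<and> (\<forall>i \<in> {1..k - r}. weight R K k S i \<noteq> 0)"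

definition span_set :: "('a, 'b) ring_scheme \<Rightarrow> 'a set \<Rightarrow> 'a set \<Rightarrow> 'a set" where
  "span_set R K A = \<Inter> {W. subalgebra K W R \<and> A \<subseteq> W}"

end

theory Submission
  imports Defs
begin

text \<open>Write \<open>F\<close> for the field with \<open>q ^ t\<close> elements, \<open>P j\<close> for the polynomials of degree less than \<open>j\<close>
  in \<open>lam\<close>, and \<open>s = t - m\<close>. The hyperplane \<open>H = Sbar + b P (t - 1)\<close> makes
  \<open>(v, x) \<mapsto> v x mod H\<close> a nondegenerate bilinear form, for which \<open>S\<close> is the orthogonal of \<open>P s\<close>.
  Hence \<open>d(S, \<alpha> S)\<close> is determined by \<open>dim (P s \<inter> \<alpha>\<inverse> P s)\<close>. Since \<open>2 s < t\<close>, this dimension is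
  \<open>s - i\<close> when \<open>\<alpha>\<close> is a quotient of coprime polynomials in \<open>lam\<close> of maximal degree \<open>i < s\<close>, and \<open>0\<close>
  otherwise. Counting the pairs \<open>(v, \<alpha> v)\<close> of nonzero elements of \<open>P s\<close> for every \<open>s\<close> gives the number of
  \<open>\<alpha>\<close> of each degree recursively, and each code word arises from \<open>q - 1\<close> values of \<open>\<alpha>\<close>.\<close>

section \<open>Subfields of a finite field\<close>

text \<open>The hypothesis \<open>t < 2 * m\<close> says \<open>2 * s < t\<close>. It lets elements
  of \<open>P (Suc s)\<close> be handled as polynomials: a product of two of them has degree below
  \<open>t\<close>, so no reduction modulo the minimal polynomial of \<open>lam\<close> occurs and
  degrees add. Quotients then count like rational functions over a field with \<open>q\<close>
  elements, of which \<open>q ^ (2 * i + 1) - q ^ (2 * i - 1)\<close> have degree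
  \<open>i > 0\<close>; division by \<open>q - 1\<close> yields
  \<open>(q + 1) * q ^ (2 * i - 1)\<close>. The scalars of degree below \<open>s\<close> number
  \<open>q ^ (2 * s - 1) - 1\<close>, and the rest of the \<open>q ^ n - 1\<close> nonzero scalars
  give the last weight. The condition on \<open>Y\<close> enters as
  \<open>carrier R = Sbar + b F\<close>. It forces \<open>n = t * (l + 1)\<close>, hence
  \<open>k = n - s\<close>, and makes \<open>H\<close> a hyperplane. Coprimality is never expressed.
  Its role is taken by the growth in \<open>j\<close> of the space of all \<open>v\<close> in
  \<open>P j\<close> with \<open>\<alpha> v\<close> in \<open>P j\<close>: it is zero up to some
  index, the degree of \<open>\<alpha>\<close>, and from there gains one dimension per step while
  \<open>2 * j < t\<close>.\<close>

lemma (in cring) binomial_expansion: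
  assumes x: "x \<in> carrier R" and y: "y \<in> carrier R"
  shows "(x \<oplus> y) [^] n = (\<Oplus>k\<in>{..n}. add_pow R (n choose k) (x [^] k \<otimes> y [^] (n - k)))"
proof (induction n)
  case 0
  show ?case by (simp add: finsum_0 add.nat_pow_eone)
next
  case (Suc n)
  let ?f = "\<lambda>n k. add_pow R (n choose k) (x [^] k \<otimes> y [^] (n - k))"
  have cl [simp]: "add_pow R (a::nat) (x [^] k \<otimes> y [^] j) \<in> carrier R" for a and k j :: nat
    using x y by simp
  have fx: "?f n k \<otimes> x = add_pow R (n choose k) (x [^] Suc k \<otimes> y [^] (n - k))" for k
    using x y by (simp add: add_pow_ldistr add_pow_rdistr m_ac)
  have fy: "?f n k \<otimes> y = add_pow R (n choose k) (x [^] k \<otimes> y [^] (Suc n - k))" if "k \<le> n" for k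
    using x y that by (simp add: add_pow_ldistr add_pow_rdistr m_ac Suc_diff_le)
  have A: "(\<Oplus>k\<in>{..n}. ?f n k) \<otimes> x = (\<Oplus>k\<in>{..n}. add_pow R (n choose k) (x [^] Suc k \<otimes> y [^] (n - k)))"
    using x y by (subst finsum_ldistr) (auto intro!: finsum_cong' simp: fx[simplified])
  have B: "(\<Oplus>k\<in>{..n}. ?f n k) \<otimes> y
      = (\<Oplus>k\<in>{..n}. add_pow R (n choose k) (x [^] k \<otimes> y [^] (Suc n - k)))"
    using x y by (subst finsum_ldistr) (auto intro!: finsum_cong' simp del: nat_pow_Suc simp: fy)
  \<comment> \<open>The appended term vanishes because \<open>n choose Suc n = 0\<close>. With it,
    splitting off the term at \<open>0\<close> and shifting the index gives a sum over
    \<open>{..n}\<close> again, ready for Pascal's rule.\<close>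
  have "\<dots> = (\<Oplus>k\<in>{..Suc n}. add_pow R (n choose k) (x [^] k \<otimes> y [^] (Suc n - k)))"
    using x y by (subst finsum_Suc) (auto simp: finsum_closed binomial_eq_0 add.nat_pow_0)
  also have "\<dots> = (\<Oplus>k\<in>{..n}. add_pow R (n choose Suc k) (x [^] Suc k \<otimes> y [^] (n - k)))
      \<oplus> y [^] Suc n"
    using x y by (subst finsum_Suc2) (auto simp: add.nat_pow_eone simp del: nat_pow_Suc)
  finally have C: "(\<Oplus>k\<in>{..n}. ?f n k) \<otimes> y
      = (\<Oplus>k\<in>{..n}. add_pow R (n choose Suc k) (x [^] Suc k \<otimes> y [^] (n - k))) \<oplus> y [^] Suc n"
    using B by simp
  have "(x \<oplus> y) [^] Suc n = (\<Oplus>k\<in>{..n}. ?f n k) \<otimes> x \<oplus> (\<Oplus>k\<in>{..n}. ?f n k) \<otimes> y"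
    using x y Suc by (simp add: r_distr finsum_closed)
  also have "\<dots> = (\<Oplus>k\<in>{..n}. add_pow R (n choose k) (x [^] Suc k \<otimes> y [^] (n - k)))
      \<oplus> (\<Oplus>k\<in>{..n}. add_pow R (n choose Suc k) (x [^] Suc k \<otimes> y [^] (n - k))) \<oplus> y [^] Suc n"
    unfolding A C using x y
    by (subst a_assoc) (auto intro!: finsum_closed simp del: nat_pow_Suc)
  also have "(\<Oplus>k\<in>{..n}. add_pow R (n choose k) (x [^] Suc k \<otimes> y [^] (n - k)))
      \<oplus> (\<Oplus>k\<in>{..n}. add_pow R (n choose Suc k) (x [^] Suc k \<otimes> y [^] (n - k)))
     = (\<Oplus>k\<in>{..n}. add_pow R (n choose k) (x [^] Suc k \<otimes> y [^] (n - k))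
           \<oplus> add_pow R (n choose Suc k) (x [^] Suc k \<otimes> y [^] (n - k)))"
    using x y by (intro finsum_addf[symmetric]) auto
  also have "\<dots> = (\<Oplus>k\<in>{..n}. add_pow R (Suc n choose Suc k) (x [^] Suc k \<otimes> y [^] (Suc n - Suc k)))"
    using x y by (intro finsum_cong') (auto simp: add.nat_pow_mult simp del: nat_pow_Suc)
  also have "\<dots> \<oplus> y [^] Suc n = (\<Oplus>k\<in>{..Suc n}. ?f (Suc n) k)"
    using x y by (subst finsum_Suc2) (auto simp: add.nat_pow_eone simp del: nat_pow_Suc)
  finally show ?case .
qed

lemma (in cring) freshmans_dream:
  assumes p: "Factorial_Ring.prime (p::nat)" and ch: "add_pow R p \<one> = \<zero>"
    and x: "x \<in> carrier R" and y: "y \<in> carrier R"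
  shows "(x \<oplus> y) [^] p = x [^] p \<oplus> y [^] p"
proof -
  have pz: "add_pow R (a * p) z = \<zero>" if "z \<in> carrier R" for z and a :: nat
  proof -
    have "add_pow R p z = (add_pow R p \<one>) \<otimes> z" using that by (simp add: add_pow_ldistr)
    then have "add_pow R p z = \<zero>" using that ch by simp
    then show ?thesis using that add.nat_pow_pow[of z p a] add.nat_pow_pow[of z a p] by (simp add: mult.commute add.nat_pow_one)
  qed
  \<comment> \<open>In this form the inner indices \<open>1, ..., p - 1\<close> are exactly
    \<open>Suc k\<close> with \<open>k \<le> r\<close>.\<close>
  obtain r where r: "p = Suc (Suc r)"
    using prime_ge_2_nat[OF p] by (metis Suc_le_D numeral_2_eq_2 Suc_le_mono)
  let ?f = "\<lambda>k. add_pow R (p choose k) (x [^] k \<otimes> y [^] (p - k))"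
  have mid: "?f (Suc k) = \<zero>" if "k \<le> r" for k
  proof -
    have "p dvd (p choose Suc k)" using that r p by (intro dvd_choose_prime) auto
    then show ?thesis using x y by (metis dvdE mult.commute pz m_closed nat_pow_closed)
  qed
  have "(x \<oplus> y) [^] p = (\<Oplus>k\<in>{..p}. ?f k)" using binomial_expansion x y .
  also have "\<dots> = (\<Oplus>k\<in>{..r}. ?f (Suc k)) \<oplus> ?f 0 \<oplus> ?f p"
  proof -
    have "(\<Oplus>k\<in>{..Suc (Suc r)}. ?f k) = ?f (Suc (Suc r)) \<oplus> (\<Oplus>k\<in>{..Suc r}. ?f k)"
      using x y by (subst finsum_Suc) auto
    also have "(\<Oplus>k\<in>{..Suc r}. ?f k) = (\<Oplus>k\<in>{..r}. ?f (Suc k)) \<oplus> ?f 0"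
      using x y by (subst finsum_Suc2) auto
    finally show ?thesis unfolding r[symmetric] using x y
      by (simp add: a_comm a_closed finsum_closed Pi_def)
  qed
  also have "(\<Oplus>k\<in>{..r}. ?f (Suc k)) = \<zero>"
    using mid by (intro add.finprod_one_eqI) auto
  finally show ?thesis using x y by (simp add: add.nat_pow_eone a_comm)
qed

lemma (in cring) freshmans_dream_power:
  assumes "Factorial_Ring.prime (p::nat)" and "add_pow R p \<one> = \<zero>"
    and x: "x \<in> carrier R" and y: "y \<in> carrier R"
  shows "(x \<oplus> y) [^] (p ^ e) = x [^] (p ^ e) \<oplus> y [^] (p ^ e)"
proof (induction e)
  case (Suc e)
  have "(x \<oplus> y) [^] (p ^ Suc e) = ((x \<oplus> y) [^] (p ^ e)) [^] p"
    using x y by (simp add: nat_pow_pow mult.commute)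
  also have "\<dots> = (x [^] (p ^ e)) [^] p \<oplus> (y [^] (p ^ e)) [^] p"
    using Suc freshmans_dream[OF assms(1,2)] x y by simp
  finally show ?case using x y by (simp add: nat_pow_pow mult.commute)
qed (use x y in simp)

text \<open>The order \<open>p ^ N\<close> of the additive group annihilates \<open>\<one>\<close>,
  and \<open>p ^ N\<close> times \<open>\<one>\<close> is the \<open>N\<close>-th power of
  \<open>p\<close> times \<open>\<one>\<close>. A field has no nonzero nilpotent elements.\<close>

lemma (in field) char_eq_zero_of_card:
  assumes fin: "finite (carrier R)" and c: "card (carrier R) = p ^ N"
  shows "add_pow R p \<one> = \<zero>"
proof -
  have "add_pow R (p ^ N) \<one> = \<zero>"
    using add.pow_order_eq_1[of "\<one>"] c by (simp add: order_def)
  moreover have "add_pow R (p ^ N) \<one> = (add_pow R p \<one>) [^] N" for N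
  proof (induction N)
    case (Suc N)
    have "add_pow R (p ^ Suc N) \<one> = add_pow R (p ^ N) (add_pow R p \<one>)"
      by (simp add: add.nat_pow_pow mult.commute)
    also have "\<dots> = add_pow R (p ^ N) \<one> \<otimes> (add_pow R p \<one>)" by (simp add: add_pow_ldistr)
    finally show ?case using Suc by simp
  qed (simp add: add.nat_pow_eone)
  ultimately have z: "(add_pow R p \<one>) [^] N = \<zero>" by simp
  show ?thesis
  proof (rule ccontr)
    assume "add_pow R p \<one> \<noteq> \<zero>"
    then have "(add_pow R p \<one>) [^] j \<noteq> \<zero>" for j :: nat
      by (induction j) (simp_all add: integral_iff)
    then show False using z by simp
  qed
qed

lemma (in field) pow_card_minus_1:
  assumes fin: "finite (carrier R)" and x: "x \<in> carrier R - {\<zero>}"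
  shows "x [^] (card (carrier R) - 1) = \<one>"
proof -
  interpret G: group "Multiplicative_Group.mult_of R" by (rule field_mult_group)
  have "x [^]\<^bsub>Multiplicative_Group.mult_of R\<^esub> order (Multiplicative_Group.mult_of R) = \<one>\<^bsub>Multiplicative_Group.mult_of R\<^esub>"
    using x by (intro G.pow_order_eq_1) simp
  then show ?thesis using order_mult_of[OF fin] by (simp add: Multiplicative_Group.nat_pow_mult_of order_def)
qed

lemma (in field) pow_card_eq:
  assumes fin: "finite (carrier R)" and x: "x \<in> carrier R"
  shows "x [^] card (carrier R) = x"
proof -
  have pos: "card (carrier R) > 0" using fin zero_closed card_gt_0_iff by blast
  show ?thesis
  proof (cases "x = \<zero>")
    case True
    then show ?thesis using pos by (simp add: nat_pow_zero)
  next
    case False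
    have "x [^] card (carrier R) = x [^] (card (carrier R) - 1) \<otimes> x"
      using pos x by (metis Suc_diff_1 nat_pow_Suc)
    then show ?thesis using pow_card_minus_1[OF fin] x False by simp
  qed
qed

section \<open>Fixed points of power maps and roots of unity\<close>

lemma (in field) Fsub_Suc_eq:
  assumes "d > 0"
  shows "Fsub R (Suc d) = insert \<zero> {x \<in> carrier R. x [^] d = \<one>}"
proof -
  have "x [^] d \<otimes> x = x \<longleftrightarrow> x [^] d = \<one>" if "x \<in> carrier R" "x \<noteq> \<zero>" for x
    using that m_rcancel[of x "x [^] d" "\<one>"] by simp
  then show ?thesis unfolding Fsub_def using assms by (auto simp: nat_pow_zero)
qed

lemma (in field) card_Fsub_le:
  assumes fin: "finite (carrier R)" and e: "e > 1"
  shows "card (Fsub R e) \<le> e"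
proof -
  obtain d where d: "e = Suc d" "d > 0" using e by (cases e) auto
  have "card (Fsub R e) \<le> Suc (card {x \<in> carrier R. x [^] d = \<one>})"
    unfolding d(1) Fsub_Suc_eq[OF d(2)] using fin by (simp add: card_insert_if)
  then show ?thesis using num_roots_le_deg[OF fin, of d] d by simp
qed

text \<open>If \<open>a\<close> generates the multiplicative group, of order
  \<open>N = d * c\<close>, then the powers \<open>a [^] (c * i)\<close> with \<open>i < d\<close>
  are \<open>d\<close> distinct solutions. A polynomial of degree \<open>d\<close> has no
  more.\<close>

lemma (in field) card_roots_of_unity:
  assumes fin: "finite (carrier R)" and d: "d dvd card (carrier R) - 1"
  shows "card {x \<in> carrier R. x [^] d = \<one>} = d"
proof -
  interpret G: group "Multiplicative_Group.mult_of R" by (rule field_mult_group)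
  obtain a where a: "a \<in> carrier (Multiplicative_Group.mult_of R)" "carrier (Multiplicative_Group.mult_of R) = {a [^] i | i::nat. i \<in> UNIV}"
    using finite_field_mult_group_has_gen[OF fin] by blast
  define N where "N = card (carrier R) - 1"
  have oN: "order (Multiplicative_Group.mult_of R) = N" using order_mult_of[OF fin] by (simp add: N_def order_def)
  have N: "N > 0" unfolding N_def
    using card_mono[OF fin, of "{\<zero>, \<one>}"] by simp
  have aR: "a \<in> carrier R" "a \<noteq> \<zero>" using a(1) by auto
  obtain c where c: "N = d * c" using d N_def by auto
  have dpos: "d > 0" "c > 0" using N c by auto
  \<comment> \<open>The first \<open>N\<close> powers already exhaust a group of order
    \<open>N\<close>, so they are distinct by counting.\<close>
  have inj: "inj_on (\<lambda>i. a [^] i) {..<N}"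
  proof -
    have "(\<lambda>i::nat. a [^] i) ` {..<N} = carrier (Multiplicative_Group.mult_of R)"
    proof -
      have aN: "a [^] N = \<one>" using pow_card_minus_1[OF fin] aR N_def by simp
      have "a [^] i = a [^] (i mod N)" for i :: nat
      proof -
        have "a [^] i = a [^] (N * (i div N) + i mod N)" by simp
        also have "\<dots> = (a [^] N) [^] (i div N) \<otimes> a [^] (i mod N)"
          using aR by (simp add: nat_pow_mult nat_pow_pow)
        finally show ?thesis using aN aR by simp
      qed
      then show ?thesis unfolding a(2) using N by (force simp: image_iff)
    qed
    moreover have "card (carrier (Multiplicative_Group.mult_of R)) = N" using oN by (simp add: order_def)
    ultimately show ?thesis by (intro eq_card_imp_inj_on) simp_all
  qed
  have "(\<lambda>i. a [^] (c * i)) ` {..<d} \<subseteq> {x \<in> carrier R. x [^] d = \<one>}"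
  proof safe
    fix i :: nat
    have "(a [^] (c * i)) [^] d = (a [^] N) [^] i"
      using aR by (simp add: nat_pow_pow c mult_ac)
    then show "(a [^] (c * i)) [^] d = \<one>"
      using pow_card_minus_1[OF fin, of a] aR N_def by simp
  qed (use aR in simp)
  moreover have "inj_on (\<lambda>i. a [^] (c * i)) {..<d}"
  proof (rule inj_onI)
    fix i j assume ij: "i \<in> {..<d}" "j \<in> {..<d}" and eq: "a [^] (c * i) = a [^] (c * j)"
    have "c * i < N" "c * j < N" using ij c dpos by (simp_all add: mult.commute)
    then have "c * i = c * j" by (intro inj_onD[OF inj eq]) simp_all
    then show "i = j" using dpos by simp
  qed
  ultimately have "d \<le> card {x \<in> carrier R. x [^] d = \<one>}"
    by (metis (no_types, lifting) card_image card_lessThan card_mono fin finite_Collect_conjI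
        finite_subset mem_Collect_eq subsetI)
  then show ?thesis using num_roots_le_deg[OF fin, of d] dpos by simp
qed

lemma (in field) card_Fsub:
  assumes fin: "finite (carrier R)" and c: "card (carrier R) = q ^ n" and q: "q > 1"
  shows "card (Fsub R q) = q"
proof -
  have "int q - 1 dvd int q ^ n - 1"
    by (metis power_diff_1_eq dvd_triv_left)
  then have "int (q - 1) dvd int (q ^ n - 1)"
    using q by (simp add: of_nat_diff)
  then have "q - 1 dvd card (carrier R) - 1" unfolding c using int_dvd_int_iff by blast
  then have *: "card {x \<in> carrier R. x [^] (q - 1) = \<one>} = q - 1"
    by (rule card_roots_of_unity[OF fin])
  have "Fsub R q = insert \<zero> {x \<in> carrier R. x [^] (q - 1) = \<one>}"
    using Fsub_Suc_eq[of "q - 1"] q by simp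
  moreover have "\<zero> \<notin> {x \<in> carrier R. x [^] (q - 1) = \<one>}"
    using q by (simp add: nat_pow_zero)
  ultimately show ?thesis using * fin q by simp
qed

lemma (in field) subfield_Fsub:
  assumes fin: "finite (carrier R)" and c: "card (carrier R) = (p ^ e) ^ n"
    and p: "Factorial_Ring.prime (p::nat)"
  shows "subfield (Fsub R (p ^ e)) R"
proof (rule subfieldI')
  let ?q = "p ^ e"
  have ch: "add_pow R p \<one> = \<zero>"
    using char_eq_zero_of_card[OF fin, of p "e * n"] c by (simp add: power_mult)
  have q: "?q > 0" using p by (simp add: prime_gt_0_nat)
  have add: "x \<oplus> y \<in> Fsub R ?q" if "x \<in> Fsub R ?q" "y \<in> Fsub R ?q" for x y
    using that freshmans_dream_power[OF p ch] unfolding Fsub_def by simp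
  show "subring (Fsub R ?q) R"
  proof (rule subringI)
    fix h assume h: "h \<in> Fsub R ?q"
    then have hc: "h \<in> carrier R" "h [^] ?q = h" by (auto simp: Fsub_def)
    \<comment> \<open>Additivity of the power map gives the sign without distinguishing even from
      odd \<open>?q\<close>.\<close>
    have "h [^] ?q \<oplus> (\<ominus> h) [^] ?q = (h \<oplus> \<ominus> h) [^] ?q"
      using freshmans_dream_power[OF p ch, of h "\<ominus> h" e] hc by simp
    also have "\<dots> = \<zero>" using hc q by (simp add: r_neg nat_pow_zero)
    finally have "(\<ominus> h) [^] ?q = \<ominus> h"
      using hc minus_equality[of "(\<ominus> h) [^] ?q" h] by (simp add: a_comm)
    then show "\<ominus> h \<in> Fsub R ?q" using hc by (simp add: Fsub_def)
  qed (auto simp: Fsub_def add[unfolded Fsub_def, simplified] nat_pow_distrib)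
  fix k assume k: "k \<in> Fsub R ?q - {\<zero>}"
  then have kc: "k \<in> Units R" "k [^] ?q = k" by (auto simp: Fsub_def field_Units)
  then have "k \<otimes> (inv k) [^] ?q = \<one>"
    using nat_pow_distrib[of k "inv k" ?q] Units_closed[OF kc(1)] by simp
  then have "(inv k) [^] ?q = inv k"
    using kc(1) comm_inv_char[of k "(inv k) [^] ?q"] Units_closed[OF kc(1)] by simp
  then show "inv k \<in> Fsub R ?q" using kc by (simp add: Fsub_def)
qed

section \<open>Subspaces and their cardinalities\<close>

locale finite_field_over = field R for R (structure) +
  fixes K
  assumes fin: "finite (carrier R)" and K: "subfield K R"
begin

text \<open>Despite its name, \<open>subalgebra\<close> asks only for an additive subgroup closed
  under scalars from \<open>K\<close>, which is a linear subspace.\<close>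

abbreviation subspace where "subspace V \<equiv> subalgebra K V R"

lemma K_carrier: "K \<subseteq> carrier R" and one_K: "\<one> \<in> K" and zero_K: "\<zero> \<in> K"
  using subfieldE(3)[OF K] subringE(2,3)[OF subfieldE(1)[OF K]] by auto

lemma finite_K: "finite K"
  using fin K_carrier finite_subset by blast

lemma card_K_gt_1: "card K > 1"
proof -
  have "card {\<zero>, \<one>} \<le> card K"
    using one_K zero_K finite_K by (intro card_mono) auto
  then show ?thesis by simp
qed

lemma inv_K: "k \<in> K - {\<zero>} \<Longrightarrow> inv k \<in> K"
  using subfield_m_inv(1)[OF K] by blast

lemma inv_nonzero: "a \<in> carrier R - {\<zero>} \<Longrightarrow> inv a \<in> carrier R - {\<zero>}"
  using Units_inv_Units[of a] field_Units by simp

lemma mult_inv_cancel: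
  assumes "a \<in> carrier R - {\<zero>}" "x \<in> carrier R"
  shows "a \<otimes> (inv a \<otimes> x) = x" "inv a \<otimes> (a \<otimes> x) = x"
proof -
  have "a \<in> Units R" using assms(1) field_Units by blast
  then show "a \<otimes> (inv a \<otimes> x) = x" "inv a \<otimes> (a \<otimes> x) = x"
    using assms by (simp_all flip: m_assoc)
qed

lemma subspaceI:
  assumes "V \<subseteq> carrier R" "\<zero> \<in> V" "\<And>u v. u \<in> V \<Longrightarrow> v \<in> V \<Longrightarrow> u \<oplus> v \<in> V"
    "\<And>k v. k \<in> K \<Longrightarrow> v \<in> V \<Longrightarrow> k \<otimes> v \<in> V"
  shows "subspace V"
proof (intro subalgebra.intro subalgebra_axioms.intro)
  show "subgroup V (add_monoid R)"
  proof (rule add.subgroupI)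
    fix a assume a: "a \<in> V"
    have "\<ominus> \<one> \<in> K" using one_K subringE(5)[OF subfieldE(1)[OF K]] by blast
    then have "\<ominus> \<one> \<otimes> a \<in> V" using assms(4) a by blast
    then show "\<ominus> a \<in> V" using a assms(1) using l_minus[of \<one> a] by auto
  qed (use assms in auto)
qed (use assms in auto)

lemma subspaceD:
  assumes "subspace V"
  shows "V \<subseteq> carrier R" "\<zero> \<in> V" "\<And>u v. u \<in> V \<Longrightarrow> v \<in> V \<Longrightarrow> u \<oplus> v \<in> V"
    "\<And>k v. k \<in> K \<Longrightarrow> v \<in> V \<Longrightarrow> k \<otimes> v \<in> V" "\<And>v. v \<in> V \<Longrightarrow> \<ominus> v \<in> V"
    "\<And>u v. u \<in> V \<Longrightarrow> v \<in> V \<Longrightarrow> u \<ominus> v \<in> V"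
proof -
  interpret V: subalgebra K V R by fact
  show "V \<subseteq> carrier R" using V.subset by simp
  show z: "\<zero> \<in> V" using V.one_closed by simp
  show a: "u \<oplus> v \<in> V" if "u \<in> V" "v \<in> V" for u v using V.m_closed that by simp
  show "k \<otimes> v \<in> V" if "k \<in> K" "v \<in> V" for k v using V.smult_closed that .
  show m: "\<ominus> v \<in> V" if "v \<in> V" for v using add.subgroupE(3)[OF V.is_subgroup] that by simp
  show "u \<ominus> v \<in> V" if "u \<in> V" "v \<in> V" for u v using a m that by (simp add: a_minus_def)
qed

lemma finite_subspace: "subspace V \<Longrightarrow> finite V"
  using subspaceD(1) fin finite_subset by blast

lemma subspace_smult_iff:
  assumes V: "subspace V" and k: "k \<in> K - {\<zero>}" and v: "v \<in> carrier R"
  shows "k \<otimes> v \<in> V \<longleftrightarrow> v \<in> V"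
proof
  assume "k \<otimes> v \<in> V"
  then have "inv k \<otimes> (k \<otimes> v) \<in> V" using subspaceD(4)[OF V] inv_K k by blast
  moreover have "inv k \<otimes> (k \<otimes> v) = v"
    using mult_inv_cancel(2)[of k v] k v K_carrier by blast
  ultimately show "v \<in> V" by simp
qed (use subspaceD(4)[OF V] k in blast)

lemma subspace_carrier: "subspace (carrier R)"
  using carrier_is_subalgebra K_carrier by blast

section \<open>Cardinalities in place of dimensions\<close>

lemma finite_dimension_subspace:
  assumes "subspace V"
  shows "finite_dimension K V"
proof -
  obtain Us where Us: "set Us = carrier R" using fin finite_list by blast
  have "Span K Us = carrier R"
    using Span_base_incl[OF K, of Us] Span_in_carrier[OF K_carrier, of Us] Us by blast
  then have "finite_dimension K (carrier R)"
    using Span_finite_dimension[OF K, of Us] Us by simp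
  then show ?thesis
    using subalbegra_incl_imp_finite_dimension[OF K _ assms] subspaceD(1)[OF assms] by blast
qed

text \<open>As \<open>v\<close> lies outside \<open>E'\<close>, the map sending
  \<open>(k, u)\<close> to \<open>k v + u\<close> is injective, so each extension multiplies the
  size by \<open>card K\<close>. Linear algebra is mostly phrased with sizes from here on: they
  combine directly with the counting arguments and avoid truncated subtraction.\<close>

lemma card_dimension:
  assumes "dimension n K E"
  shows "card E = card K ^ n"
  using assms
proof (induction n arbitrary: E)
  case 0
  then have "E = {\<zero>}" using dimension_zero[OF K] by blast
  then show ?case by simp
next
  case (Suc n)
  from Suc.prems obtain v E' where v: "v \<in> carrier R" "v \<notin> E'" "dimension n K E'"
    and E: "E = line_extension K v E'"
    by (cases rule: dimension.cases) auto
  have E': "subspace E'"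
    using v(3) finite_dimension_imp_subalgebra[OF K] finite_dimensionI by blast
  note E'D = subspaceD[OF E']
  let ?f = "\<lambda>(k, u). k \<otimes> v \<oplus> u"
  have "E = ?f ` (K \<times> E')"
    unfolding E by (rule Set.set_eqI) (auto simp: line_extension_mem_iff image_iff)
  moreover have "inj_on ?f (K \<times> E')"
  proof (rule inj_onI, clarify)
    fix k u k' u' assume k: "k \<in> K" "k' \<in> K" and u: "u \<in> E'" "u' \<in> E'"
      and eq: "k \<otimes> v \<oplus> u = k' \<otimes> v \<oplus> u'"
    have c: "k \<in> carrier R" "k' \<in> carrier R" "u \<in> carrier R" "u' \<in> carrier R"
      using k u K_carrier E'D(1) by auto
    have "(k \<ominus> k') \<otimes> v = (k \<otimes> v \<oplus> u) \<ominus> u \<ominus> k' \<otimes> v"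
      using c v(1) by algebra
    also have "\<dots> = u' \<ominus> u" unfolding eq using c v(1) by algebra
    finally have d: "(k \<ominus> k') \<otimes> v = u' \<ominus> u" .
    have "k \<ominus> k' \<in> K"
      using k subringE(5,7)[OF subfieldE(1)[OF K]] by (simp add: a_minus_def)
    moreover have "(k \<ominus> k') \<otimes> v \<in> E'" unfolding d using E'D(6) u by blast
    ultimately have "k \<ominus> k' = \<zero>"
      using subspace_smult_iff[OF E', of "k \<ominus> k'" v] v by blast
    then have "k = k'" using c by simp
    moreover have "u = u'" using eq c v(1) unfolding \<open>k = k'\<close> by simp
    ultimately show "k = k' \<and> u = u'" by simp
  qed
  ultimately have "card E = card (K \<times> E')" by (simp add: card_image)
  then show ?case using Suc.IH[OF v(3)] by (simp add: card_cartesian_product)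
qed

lemma dimension_subspace: "subspace V \<Longrightarrow> dimension (dim K V) K V"
  using finite_dimensionE[OF K finite_dimension_subspace] by (simp add: over_def)

lemma card_subspace: "subspace V \<Longrightarrow> card V = card K ^ dim K V"
  using card_dimension dimension_subspace by blast

lemma card_subspace_pos: "subspace V \<Longrightarrow> card V > 0"
  using card_subspace card_K_gt_1 by simp

lemma subspace_Int: "subspace A \<Longrightarrow> subspace B \<Longrightarrow> subspace (A \<inter> B)"
  using subalgebra_inter by blast

lemma set_add_iff: "x \<in> A <+>\<^bsub>R\<^esub> B \<longleftrightarrow> (\<exists>a\<in>A. \<exists>b\<in>B. x = a \<oplus> b)"
  unfolding set_add_def' by blast

lemma subspace_add:
  assumes A: "subspace A" and B: "subspace B"
  shows "subspace (A <+>\<^bsub>R\<^esub> B)" and "A \<subseteq> A <+>\<^bsub>R\<^esub> B" and "B \<subseteq> A <+>\<^bsub>R\<^esub> B"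
proof -
  have "dimension (dim K A + dim K B - dim K (A \<inter> B)) K (A <+>\<^bsub>R\<^esub> B)"
    using dimension_sum_space[OF K] dimension_subspace subspace_Int A B by blast
  then show "subspace (A <+>\<^bsub>R\<^esub> B)"
    using finite_dimension_imp_subalgebra[OF K] finite_dimensionI by blast
  show "A \<subseteq> A <+>\<^bsub>R\<^esub> B"
  proof
    fix a assume a: "a \<in> A"
    then have "a = a \<oplus> \<zero>" using subspaceD(1)[OF A] by auto
    then show "a \<in> A <+>\<^bsub>R\<^esub> B" using a subspaceD(2)[OF B] set_add_iff by blast
  qed
  show "B \<subseteq> A <+>\<^bsub>R\<^esub> B"
  proof
    fix b assume b: "b \<in> B"
    then have "b = \<zero> \<oplus> b" using subspaceD(1)[OF B] by auto
    then show "b \<in> A <+>\<^bsub>R\<^esub> B" using b subspaceD(2)[OF A] set_add_iff by blast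
  qed
qed

lemma card_subspace_mono: "subspace B \<Longrightarrow> A \<subseteq> B \<Longrightarrow> card A \<le> card B"
  using card_mono finite_subspace by blast

lemma card_subspace_add:
  assumes A: "subspace A" and B: "subspace B"
  shows "card (A <+>\<^bsub>R\<^esub> B) * card (A \<inter> B) = card A * card B"
proof -
  have "dimension (dim K A + dim K B - dim K (A \<inter> B)) K (A <+>\<^bsub>R\<^esub> B)"
    using dimension_sum_space[OF K] dimension_subspace subspace_Int A B by blast
  then have "card (A <+>\<^bsub>R\<^esub> B) = card K ^ (dim K A + dim K B - dim K (A \<inter> B))"
    using card_dimension by blast
  \<comment> \<open>Ensures that the subtraction of natural numbers in the exponent is not
    truncated.\<close>
  moreover have "dim K (A \<inter> B) \<le> dim K A"
  proof -
    have "card (A \<inter> B) \<le> card A" using card_subspace_mono[OF A] by blast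
    then show ?thesis
      using power_le_imp_le_exp[OF card_K_gt_1]
      unfolding card_subspace[OF A] card_subspace[OF subspace_Int[OF A B]] by blast
  qed
  ultimately show ?thesis
    using card_subspace[OF A] card_subspace[OF B] card_subspace[OF subspace_Int[OF A B]]
    by (simp flip: power_add)
qed

text \<open>Both sizes are powers of \<open>card K\<close>, so a strict increase is at least by this
  factor.\<close>

lemma card_strict_subspace:
  assumes A: "subspace A" and B: "subspace B" and AB: "A \<subset> B"
  shows "card K * card A \<le> card B"
proof -
  have "card A < card B" using psubset_card_mono[OF finite_subspace[OF B] AB] .
  then have "dim K A < dim K B"
    using card_subspace A B card_K_gt_1 by (simp add: power_strict_increasing_iff)
  then have "card K ^ Suc (dim K A) \<le> card K ^ dim K B"
    using card_K_gt_1 by (intro power_increasing) auto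
  then show ?thesis using card_subspace A B by simp
qed

lemma subspace_line_extension:
  assumes H: "subspace H" and w: "w \<in> carrier R"
  shows "subspace (line_extension K w H)" "H \<subseteq> line_extension K w H"
    "card (line_extension K w H) \<le> card K * card H"
proof -
  have e: "line_extension K w H = Span K [w] <+>\<^bsub>R\<^esub> H"
  proof -
    have kw: "k \<otimes> w \<oplus> \<zero> = k \<otimes> w" if "k \<in> K" for k
      using that w K_carrier by auto
    have "Span K [w] = K #> w"
      by (rule Set.set_eqI) (auto simp: line_extension_mem_iff r_coset_def kw)
    then show ?thesis by (simp add: line_extension_def)
  qed
  have S: "subspace (Span K [w])" by (rule Span_is_subalgebra[OF K]) (use w in simp)
  show "subspace (line_extension K w H)" "H \<subseteq> line_extension K w H"
    unfolding e using subspace_add[OF S H] by auto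
  have "line_extension K w H = (\<lambda>(k, u). k \<otimes> w \<oplus> u) ` (K \<times> H)"
    by (rule Set.set_eqI) (auto simp: line_extension_mem_iff image_iff)
  then show "card (line_extension K w H) \<le> card K * card H"
    by (metis card_image_le card_cartesian_product finite_cartesian_product finite_K finite_subspace[OF H])
qed

text \<open>The sum of \<open>V\<close> and \<open>H\<close> strictly contains \<open>H\<close> and
  lies in an extension of \<open>H\<close> by one vector, so its size is
  \<open>card K * card H\<close>. The dimension formula then gives the size of the
  intersection.\<close>

lemma card_Int_hyperplane:
  assumes V: "subspace V" and H: "subspace H" and w: "w \<in> carrier R"
    and VH: "V \<subseteq> line_extension K w H" and nH: "\<not> V \<subseteq> H"
  shows "card V = card K * card (V \<inter> H)"
proof -
  note L = subspace_line_extension[OF H w]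
  note VHs = subspace_add[OF V H]
  have "V <+>\<^bsub>R\<^esub> H \<subseteq> line_extension K w H"
    using VH L(2) subspaceD(3)[OF L(1)] unfolding subset_iff set_add_iff by blast
  then have "card (V <+>\<^bsub>R\<^esub> H) \<le> card K * card H"
    using card_subspace_mono[OF L(1)] L(3) order_trans by blast
  moreover have "card K * card H \<le> card (V <+>\<^bsub>R\<^esub> H)"
    using card_strict_subspace[OF H VHs(1)] VHs(2,3) nH by blast
  ultimately have "card (V <+>\<^bsub>R\<^esub> H) = card K * card H" by simp
  then have "card K * card H * card (V \<inter> H) = card V * card H"
    using card_subspace_add[OF V H] by simp
  then show ?thesis using card_subspace_pos[OF H] by simp
qed

lemma card_le_Int_hyperplane:
  assumes V: "subspace V" and H: "subspace H" and w: "w \<in> carrier R"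
    and VH: "V \<subseteq> line_extension K w H"
  shows "card V \<le> card K * card (V \<inter> H)"
proof (cases "V \<subseteq> H")
  case True
  then show ?thesis using card_K_gt_1 by (simp add: Int_absorb2)
qed (use card_Int_hyperplane[OF assms] in simp)

section \<open>Scalar multiples of subspaces\<close>

lemma inj_on_mult:
  assumes "a \<in> carrier R - {\<zero>}" "A \<subseteq> carrier R"
  shows "inj_on (\<lambda>x. a \<otimes> x) A"
proof (rule inj_onI)
  fix x y assume "x \<in> A" "y \<in> A" "a \<otimes> x = a \<otimes> y"
  then show "x = y" using m_lcancel[of a x y] assms by blast
qed

lemma mem_smul_set_iff:
  assumes "a \<in> carrier R - {\<zero>}" "V \<subseteq> carrier R"
  shows "x \<in> smul_set R a V \<longleftrightarrow> x \<in> carrier R \<and> inv a \<otimes> x \<in> V"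
proof
  assume "x \<in> smul_set R a V"
  then obtain v where v: "v \<in> V" "x = a \<otimes> v" by (auto simp: smul_set_def)
  then have "v \<in> carrier R" using assms(2) by blast
  then show "x \<in> carrier R \<and> inv a \<otimes> x \<in> V"
    using v assms(1) mult_inv_cancel(2)[OF assms(1)] by simp
next
  assume x: "x \<in> carrier R \<and> inv a \<otimes> x \<in> V"
  then have "x = a \<otimes> (inv a \<otimes> x)" using mult_inv_cancel(1)[OF assms(1)] by simp
  then show "x \<in> smul_set R a V" using x unfolding smul_set_def by blast
qed

lemma smul_set_smul_set:
  assumes "\<alpha> \<in> carrier R" "\<beta> \<in> carrier R" "V \<subseteq> carrier R"
  shows "smul_set R \<alpha> (smul_set R \<beta> V) = smul_set R (\<alpha> \<otimes> \<beta>) V"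
  unfolding smul_set_def image_image using assms by (intro image_cong) (auto simp: m_assoc)

lemma smul_set_one: "V \<subseteq> carrier R \<Longrightarrow> smul_set R \<one> V = V"
  unfolding smul_set_def by (force simp: image_iff subset_iff)

lemma subspace_smul_set:
  assumes V: "subspace V" and a: "a \<in> carrier R"
  shows "subspace (smul_set R a V)"
proof (rule subspaceI)
  note D = subspaceD[OF V]
  show "smul_set R a V \<subseteq> carrier R" using D(1) a by (auto simp: smul_set_def)
  have "a \<otimes> \<zero> \<in> smul_set R a V" using D(2) by (auto simp: smul_set_def)
  then show "\<zero> \<in> smul_set R a V" using a by simp
  fix x assume "x \<in> smul_set R a V"
  then obtain u where u: "u \<in> V" "x = a \<otimes> u" by (auto simp: smul_set_def)
  { fix y assume "y \<in> smul_set R a V"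
    then obtain v where v: "v \<in> V" "y = a \<otimes> v" by (auto simp: smul_set_def)
    have "x \<oplus> y = a \<otimes> (u \<oplus> v)" using u v a D(1) by (simp add: r_distr subsetD)
    then show "x \<oplus> y \<in> smul_set R a V" using D(3) u v by (auto simp: smul_set_def) }
  fix k assume k: "k \<in> K"
  have "k \<otimes> x = a \<otimes> (k \<otimes> u)" using u a D(1) k K_carrier by (simp add: m_lcomm subsetD)
  then show "k \<otimes> x \<in> smul_set R a V" using D(4) u k by (auto simp: smul_set_def)
qed

lemma card_smul_set:
  "a \<in> carrier R - {\<zero>} \<Longrightarrow> V \<subseteq> carrier R \<Longrightarrow> card (smul_set R a V) = card V"
  unfolding smul_set_def by (intro card_image inj_on_mult)

end

section \<open>Degrees in a simple extension\<close>

locale finite_simple_extension = finite_field_over R K for R (structure) and K +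
  fixes lam t
  assumes lam: "lam \<in> carrier R"
    and t: "t = dim K (generate_field R (insert lam K))"
begin

definition P :: "nat \<Rightarrow> 'a set" where
  "P j = Span K (map (\<lambda>i. lam [^] i) [0..<j])"

abbreviation F where "F \<equiv> generate_field R (insert lam K)"

lemma pow_lam [simp]: "lam [^] (i::nat) \<in> carrier R"
  using lam by simp

lemma subspace_P: "subspace (P j)"
  unfolding P_def by (rule Span_is_subalgebra[OF K]) auto

lemmas P_carrier = subspaceD(1)[OF subspace_P]
lemmas P_add = subspaceD(3)[OF subspace_P]
lemmas P_smult = subspaceD(4)[OF subspace_P]
lemmas P_diff = subspaceD(6)[OF subspace_P]

lemma P_0: "P 0 = {\<zero>}"
  by (simp add: P_def)

lemma P_Suc: "P (Suc j) = line_extension K (lam [^] j) (P j)"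
proof -
  have "P (Suc j) = Span K ((lam [^] j) # map (\<lambda>i. lam [^] i) [0..<j])"
    unfolding P_def by (rule Span_same_set[OF K]) auto
  then show ?thesis by (simp add: P_def)
qed

lemma P_Suc_iff: "x \<in> P (Suc j) \<longleftrightarrow> (\<exists>k\<in>K. \<exists>u\<in>P j. x = k \<otimes> lam [^] j \<oplus> u)"
  by (simp only: P_Suc line_extension_mem_iff)

lemma P_mono: "i \<le> j \<Longrightarrow> P i \<subseteq> P j"
  unfolding P_def by (intro mono_Span_sublist[OF K]) auto

lemma pow_in_P: "i < j \<Longrightarrow> lam [^] i \<in> P j"
proof -
  assume "i < j"
  then have "lam [^] i \<in> set (map (\<lambda>i. lam [^] i) [0..<j])" by simp
  moreover have "set (map (\<lambda>i. lam [^] i) [0..<j]) \<subseteq> carrier R" by auto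
  ultimately show ?thesis
    unfolding P_def using subsetD[OF Span_base_incl[OF K]] by blast
qed

lemma lam_mult_P: "u \<in> P j \<Longrightarrow> lam \<otimes> u \<in> P (Suc j)"
proof (induction j arbitrary: u)
  case 0
  then show ?case using lam subspaceD(2)[OF subspace_P] by (simp add: P_0)
next
  case (Suc j)
  then obtain k v where kv: "k \<in> K" "v \<in> P j" "u = k \<otimes> lam [^] j \<oplus> v"
    using P_Suc_iff by auto
  have c: "k \<in> carrier R" "v \<in> carrier R" using kv K_carrier P_carrier by auto
  have "lam \<otimes> u = k \<otimes> (lam [^] j \<otimes> lam) \<oplus> lam \<otimes> v"
    unfolding kv(3) using c lam pow_lam[of j] by algebra
  moreover have "lam \<otimes> v \<in> P (Suc j)" using Suc.IH kv(2) by blast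
  ultimately show ?case using kv(1) P_Suc_iff[of _ "Suc j"] by auto
qed

lemma pow_mult_P: "u \<in> P j \<Longrightarrow> lam [^] i \<otimes> u \<in> P (i + j)"
proof (induction i)
  case 0
  then show ?case using P_carrier[of j] by auto
next
  case (Suc i)
  have "lam [^] Suc i \<otimes> u = lam \<otimes> (lam [^] i \<otimes> u)"
    using Suc.prems P_carrier[of j] lam by (auto simp: m_ac)
  then show ?case using lam_mult_P Suc by simp
qed

text \<open>A degree below \<open>a\<close> and a degree at most \<open>b\<close> add up to a degree
  below \<open>a + b\<close>. The asymmetric form avoids the truncated
  \<open>a + b - 1\<close>.\<close>

lemma mult_P: "u \<in> P a \<Longrightarrow> v \<in> P (Suc b) \<Longrightarrow> u \<otimes> v \<in> P (a + b)"
proof (induction a arbitrary: u)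
  case 0
  then show ?case using P_carrier[of "Suc b"] subspaceD(2)[OF subspace_P] by (auto simp: P_0)
next
  case (Suc a)
  then obtain k w where kw: "k \<in> K" "w \<in> P a" "u = k \<otimes> lam [^] a \<oplus> w"
    using P_Suc_iff by auto
  have c: "k \<in> carrier R" "w \<in> carrier R" "v \<in> carrier R"
    using kw K_carrier P_carrier Suc.prems by auto
  have "u \<otimes> v = k \<otimes> (lam [^] a \<otimes> v) \<oplus> w \<otimes> v"
    unfolding kw(3) using c pow_lam[of a] by algebra
  moreover have "k \<otimes> (lam [^] a \<otimes> v) \<in> P (Suc a + b)"
    using P_smult[OF kw(1) pow_mult_P[OF Suc.prems(2), of a]] by simp
  moreover have "w \<otimes> v \<in> P (Suc a + b)"
    using Suc.IH[OF kw(2) Suc.prems(2)] P_mono[of "a + b" "Suc a + b"] by auto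
  ultimately show ?case using P_add by simp
qed

lemma subfield_F: "subfield F R"
  using generate_field_is_subfield lam K_carrier by simp

lemma F_carrier: "F \<subseteq> carrier R"
  using subfieldE(3)[OF subfield_F] .

lemma K_subset_F: "K \<subseteq> F"
  by (auto intro: generate_field.incl)

lemma F_subspace: "subspace F"
proof -
  note r = subringE[OF subfieldE(1)[OF subfield_F]]
  show ?thesis
    by (rule subspaceI) (use r K_subset_F in auto)
qed

lemma subspace_if_F: "subalgebra F V R \<Longrightarrow> subspace V"
  using K_subset_F unfolding subalgebra_def subalgebra_axioms_def by blast

text \<open>In a finite field \<open>lam\<close> is algebraic, so the field it generates over
  \<open>K\<close> is the ring of polynomials in \<open>lam\<close>. Its basis is given by the
  powers below the degree of the minimal polynomial, and this degree is \<open>t\<close>.\<close>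

lemma P_t: "P t = F" and card_P: "j \<le> t \<Longrightarrow> card (P j) = card K ^ j"
proof -
  have alg: "(algebraic over K) lam"
    using finite_dimension_imp_algebraic[OF K carrier_is_subring
        finite_dimension_subspace[OF subspace_carrier] lam] .
  have exp: "P j = Span K (exp_base lam j)" for j
    unfolding P_def exp_base_def by (rule Span_same_set[OF K]) auto
  have "subfield (simple_extension K lam) R"
    using simple_extension_is_subfield[OF K lam] alg by blast
  moreover have "insert lam K \<subseteq> simple_extension K lam"
    using simple_extension_mem[OF subfieldE(1)[OF K] lam] simple_extension_incl[OF K_carrier lam]
    by blast
  ultimately have "F \<subseteq> simple_extension K lam"
    using generate_field_min_subfield1 lam K_carrier by simp
  moreover have "simple_extension K lam \<subseteq> F"
    using simple_extension_subring_incl[OF subfieldE(1)[OF subfield_F] K_subset_F]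
    by (auto intro: generate_field.incl)
  ultimately have F: "F = simple_extension K lam" by blast
  have td: "t = degree (Irr K lam)"
    using simple_extension_dim[OF K lam alg] F t by (simp add: over_def)
  show "P t = F" unfolding exp td F using Span_exp_base[OF K lam alg] .
  show "card (P j) = card K ^ j" if "j \<le> t"
  proof -
    have e: "exp_base lam t = drop 0 (exp_base lam t)" by simp
    have "independent K (exp_base lam t)" using exp_base_independent[OF K lam alg] td by simp
    \<comment> \<open>\<open>exp_base\<close> lists the powers in descending order, so the lower
      powers form a tail and inherit independence.\<close>
    moreover have "exp_base lam t = take (t - j) (exp_base lam t) @ exp_base lam j"
    proof -
      have "exp_base lam j = drop (t - j) (exp_base lam t)"
        using drop_exp_base[of "t - j" lam t] that by simp
      then show ?thesis by simp
    qed
    ultimately have "independent K (exp_base lam j)" using independent_split(1)[OF K] by metis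
    then have "dimension j K (P j)"
      using dimension_independent[of K "exp_base lam j"] by (simp add: exp exp_base_def)
    then show ?thesis using card_dimension by blast
  qed
qed

lemma pow_notin_P: "j < t \<Longrightarrow> lam [^] j \<notin> P j"
proof
  assume j: "j < t" and l: "lam [^] j \<in> P j"
  have "P (Suc j) \<subseteq> P j" using P_add P_smult l by (auto simp: P_Suc_iff)
  then have "card (P (Suc j)) \<le> card (P j)" by (rule card_subspace_mono[OF subspace_P])
  then show False using card_P j card_K_gt_1 by (simp add: Suc_leI)
qed

text \<open>\<open>P (Suc j) - P j\<close> serves as the set of elements of degree exactly
  \<open>j\<close>. For \<open>j < t\<close> the power \<open>lam [^] j\<close> is independent of
  the lower ones, so the leading coefficient is well defined.\<close>

lemma P_Suc_diff_iff:
  assumes "j < t"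
  shows "x \<in> P (Suc j) - P j \<longleftrightarrow> (\<exists>k\<in>K - {\<zero>}. \<exists>u\<in>P j. x = k \<otimes> lam [^] j \<oplus> u)"
proof
  assume x: "x \<in> P (Suc j) - P j"
  then obtain k u where ku: "k \<in> K" "u \<in> P j" "x = k \<otimes> lam [^] j \<oplus> u" using P_Suc_iff by auto
  moreover have "k \<noteq> \<zero>" using x ku P_carrier[of j] by auto
  ultimately show "\<exists>k\<in>K - {\<zero>}. \<exists>u\<in>P j. x = k \<otimes> lam [^] j \<oplus> u" by blast
next
  assume "\<exists>k\<in>K - {\<zero>}. \<exists>u\<in>P j. x = k \<otimes> lam [^] j \<oplus> u"
  then obtain k u where ku: "k \<in> K - {\<zero>}" "u \<in> P j" "x = k \<otimes> lam [^] j \<oplus> u" by blast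
  have c: "k \<in> carrier R" "u \<in> carrier R" using ku K_carrier P_carrier by auto
  have "x \<notin> P j"
  proof
    assume "x \<in> P j"
    then have "x \<ominus> u \<in> P j" using ku P_diff by blast
    moreover have "x \<ominus> u = k \<otimes> lam [^] j" unfolding ku(3) using c pow_lam[of j] by algebra
    ultimately show False
      using subspace_smult_iff[OF subspace_P ku(1) pow_lam] pow_notin_P[OF assms] by auto
  qed
  then show "x \<in> P (Suc j) - P j" using ku P_Suc_iff by blast
qed

text \<open>The leading coefficients multiply to a nonzero scalar, and \<open>a + b < t\<close>
  keeps the product clear of any relation between the powers of \<open>lam\<close>.\<close>

lemma mult_P_diff:
  assumes u: "u \<in> P (Suc a) - P a" and v: "v \<in> P (Suc b) - P b" and ab: "a + b < t"
  shows "u \<otimes> v \<in> P (Suc (a + b)) - P (a + b)"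
proof -
  obtain k u' where k: "k \<in> K - {\<zero>}" "u' \<in> P a" "u = k \<otimes> lam [^] a \<oplus> u'"
    using u P_Suc_diff_iff[of a] ab by auto
  obtain l v' where l: "l \<in> K - {\<zero>}" "v' \<in> P b" "v = l \<otimes> lam [^] b \<oplus> v'"
    using v P_Suc_diff_iff[of b] ab by auto
  have c: "k \<in> carrier R" "l \<in> carrier R" "u' \<in> carrier R" "v' \<in> carrier R" "v \<in> carrier R"
    using k l K_carrier P_carrier v by auto
  have "u \<otimes> v = (k \<otimes> l) \<otimes> (lam [^] a \<otimes> lam [^] b) \<oplus> (k \<otimes> (lam [^] a \<otimes> v') \<oplus> u' \<otimes> v)"
    unfolding k(3) l(3) using c pow_lam[of a] pow_lam[of b] by algebra
  moreover have "lam [^] a \<otimes> lam [^] b = lam [^] (a + b)" using lam by (simp add: nat_pow_mult)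
  moreover have "k \<otimes> (lam [^] a \<otimes> v') \<oplus> u' \<otimes> v \<in> P (a + b)"
    using P_add[OF P_smult[OF _ pow_mult_P[OF l(2)]] mult_P[OF k(2)]] k v by blast
  moreover have "k \<otimes> l \<in> K - {\<zero>}"
    using k l c subringE(6)[OF subfieldE(1)[OF K]] by (auto simp: integral_iff)
  ultimately show ?thesis using P_Suc_diff_iff[OF ab] by metis
qed

lemma P_degree:
  assumes "x \<in> P j" "x \<noteq> \<zero>"
  obtains d where "d < j" "x \<in> P (Suc d) - P d"
proof -
  define d where "d = (LEAST i. x \<in> P (Suc i))"
  have "\<exists>i<j. x \<in> P (Suc i)"
  proof (cases j)
    case 0
    then show ?thesis using assms by (simp add: P_0)
  next
    case (Suc i)
    then show ?thesis using assms by auto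
  qed
  then obtain i where i: "i < j" "x \<in> P (Suc i)" by blast
  have "x \<in> P (Suc d)" unfolding d_def using i(2) by (rule LeastI)
  moreover have "d \<le> i" unfolding d_def using i(2) by (rule Least_le)
  moreover have "x \<notin> P d"
  proof (cases d)
    case 0
    then show ?thesis using assms by (simp add: P_0)
  next
    case (Suc e)
    then show ?thesis using not_less_Least[of e "\<lambda>i. x \<in> P (Suc i)"] d_def by auto
  qed
  ultimately show thesis using that[of d] i by simp
qed

end

section \<open>Counting quotients by degree\<close>

text \<open>The number of nonzero rational functions of degree \<open>i\<close> over a field with
  \<open>q\<close> elements. Constants form a separate case because the exponent
  \<open>2 * i - 1\<close> is truncated at \<open>i = 0\<close>.\<close>

definition degree_count :: "int \<Rightarrow> nat \<Rightarrow> int" where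
  "degree_count q i = (if i = 0 then q - 1 else (q\<^sup>2 - 1) * q ^ (2 * i - 1))"

text \<open>For \<open>i > 0\<close> the summand is
  \<open>q ^ (2 * i + 1) - q ^ (2 * i - 1)\<close>, so the sum telescopes.\<close>

lemma sum_degree_count: "(\<Sum>i<Suc s. degree_count q i) = q ^ (2 * s + 1) - 1"
proof (induction s)
  case (Suc s)
  have e: "degree_count q (Suc s) = (q\<^sup>2 - 1) * q ^ (2 * s + 1)"
    "q ^ (2 * Suc s + 1) = q\<^sup>2 * q ^ (2 * s + 1)"
    by (simp_all add: degree_count_def power2_eq_square)
  show ?case unfolding sum.lessThan_Suc[of _ "Suc s"] Suc e by (simp add: left_diff_distrib)
qed (simp add: degree_count_def)

lemma sum_degree_count_power:
  "(\<Sum>i<Suc s. degree_count q i * q ^ (Suc s - i)) = (q\<^sup>2 + q) * (q ^ s)\<^sup>2 - 2 * q ^ Suc s"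
proof (induction s)
  case 0
  then show ?case by (simp add: degree_count_def left_diff_distrib power2_eq_square)
next
  case (Suc s)
  have "(\<Sum>i<Suc s. degree_count q i * q ^ (Suc (Suc s) - i))
      = q * (\<Sum>i<Suc s. degree_count q i * q ^ (Suc s - i))"
    unfolding sum_distrib_left by (intro sum.cong) (auto simp: Suc_diff_le)
  moreover have "degree_count q (Suc s) = (q\<^sup>2 - 1) * (q * (q ^ s)\<^sup>2)"
    by (simp add: degree_count_def power_mult mult.commute[of 2] flip: power_mult)
  ultimately have "(\<Sum>i<Suc (Suc s). degree_count q i * q ^ (Suc (Suc s) - i))
      = q * ((q\<^sup>2 + q) * (q ^ s)\<^sup>2 - 2 * q ^ Suc s) + (q\<^sup>2 - 1) * (q * (q ^ s)\<^sup>2) * q"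
    using Suc unfolding sum.lessThan_Suc[of _ "Suc s"] by simp
  also have "\<dots> = (q\<^sup>2 + q) * (q * q ^ s)\<^sup>2 - 2 * (q * (q * q ^ s))"
    by (simp add: power2_eq_square algebra_simps)
  finally show ?case by simp
qed

text \<open>The right-hand side counts pairs of nonzero polynomials of degree at most
  \<open>s\<close>. A quotient of degree \<open>i\<close> comes from
  \<open>q ^ (Suc s - i) - 1\<close> of them, the nonzero multiples of its reduced form.\<close>

lemma sum_degree_count_weighted:
  "(\<Sum>i<Suc s. degree_count q i * (q ^ (Suc s - i) - 1)) = (q ^ Suc s - 1)\<^sup>2"
proof -
  have "q ^ (2 * s + 1) = q * (q ^ s)\<^sup>2"
    by (simp add: mult.commute[of 2] flip: power_mult)
  then have "(\<Sum>i<Suc s. degree_count q i * (q ^ (Suc s - i) - 1))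
    = (q\<^sup>2 + q) * (q ^ s)\<^sup>2 - 2 * (q * q ^ s) - (q * (q ^ s)\<^sup>2 - 1)"
    using sum_degree_count[of q s] sum_degree_count_power[of q s]
    by (simp add: right_diff_distrib sum_subtractf del: sum.lessThan_Suc)
  also have "\<dots> = (q * q ^ s - 1)\<^sup>2"
    by (simp add: power2_eq_square algebra_simps)
  finally show ?thesis by simp
qed

section \<open>Spaces of denominators of a field element\<close>

context finite_simple_extension
begin

text \<open>The possible denominators, together with zero, when \<open>\<beta>\<close> is written as
  a quotient of elements of \<open>P s\<close>. For nonzero \<open>\<beta>\<close> this is the
  intersection of \<open>P s\<close> with its multiple by \<open>inv \<beta>\<close>.\<close>

definition W :: "nat \<Rightarrow> 'a \<Rightarrow> 'a set" where
  "W s \<beta> = {v \<in> P s. \<beta> \<otimes> v \<in> P s}"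

abbreviation Rx where "Rx \<equiv> carrier R - {\<zero>}"

lemma finite_Rx: "finite Rx"
  using fin by simp

lemma t_pos: "t > 0"
proof (rule ccontr)
  assume "\<not> t > 0"
  then have "F = {\<zero>}" using P_t P_0 by simp
  moreover have "\<one> \<in> F" by (rule generate_field.one)
  ultimately show False by simp
qed

lemma subspace_W:
  assumes "\<beta> \<in> carrier R"
  shows "subspace (W s \<beta>)"
proof (rule subspaceI)
  show "W s \<beta> \<subseteq> carrier R" using P_carrier by (auto simp: W_def)
  show "\<zero> \<in> W s \<beta>" using subspaceD(2)[OF subspace_P] assms by (simp add: W_def)
  fix u assume u: "u \<in> W s \<beta>"
  then have uc: "u \<in> carrier R" using P_carrier by (auto simp: W_def)
  { fix v assume v: "v \<in> W s \<beta>"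
    then have "v \<in> carrier R" using P_carrier by (auto simp: W_def)
    then show "u \<oplus> v \<in> W s \<beta>"
      using u v uc assms P_add by (simp add: W_def r_distr) }
  fix k assume k: "k \<in> K"
  then have "\<beta> \<otimes> (k \<otimes> u) = k \<otimes> (\<beta> \<otimes> u)"
    using uc assms K_carrier by (simp add: m_lcomm subsetD)
  then show "k \<otimes> u \<in> W s \<beta>" using u k P_smult by (simp add: W_def)
qed

lemma W_0: "\<beta> \<in> carrier R \<Longrightarrow> W 0 \<beta> = {\<zero>}"
  by (auto simp: W_def P_0)

lemma W_mono: "W s \<beta> \<subseteq> W (Suc s) \<beta>"
  using P_mono[of s "Suc s"] by (auto simp: W_def)

text \<open>Two elements witnessing that neither coefficient of \<open>lam ^ s\<close> alone cuts out \<open>W s \<beta>\<close> would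
  give equal products of degrees at most \<open>2 * s - 2\<close> and exactly \<open>2 * s\<close>.\<close>

lemma card_W_Suc_le:
  assumes \<beta>: "\<beta> \<in> Rx" and s: "2 * s < t"
  shows "card (W (Suc s) \<beta>) \<le> card K * card (W s \<beta>)"
proof -
  let ?V = "W (Suc s) \<beta>"
  let ?B = "smul_set R (inv \<beta>) (P s)"
  have V: "subspace ?V" using subspace_W \<beta> by simp
  have ib: "inv \<beta> \<in> Rx" using inv_nonzero[OF \<beta>] .
  have B_iff: "v \<in> ?B \<longleftrightarrow> \<beta> \<otimes> v \<in> P s" if "v \<in> carrier R" for v
    using mem_smul_set_iff[OF ib P_carrier] that \<beta> field_Units by simp
  \<comment> \<open>Within \<open>?V\<close>, membership in \<open>P s\<close> and in
    \<open>?B\<close> is each one linear condition: the coefficient of \<open>lam [^] s\<close> in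
    \<open>v\<close>, respectively in \<open>\<beta> \<otimes> v\<close>, vanishes. Both together
    cut out \<open>W s \<beta>\<close>, a priori of codimension up to two; it remains to see that
    one condition implies the other.\<close>
  have V_carrier: "v \<in> carrier R" if "v \<in> ?V" for v using that P_carrier by (auto simp: W_def)
  have A: "?V \<inter> P s \<subseteq> W s \<beta>" if "?V \<inter> P s \<subseteq> ?B"
    using that B_iff V_carrier by (auto simp: W_def)
  have B: "?V \<inter> ?B \<subseteq> W s \<beta>" if "?V \<inter> ?B \<subseteq> P s"
    using that B_iff V_carrier by (auto simp: W_def)
  have "?V \<inter> P s \<subseteq> ?B \<or> ?V \<inter> ?B \<subseteq> P s"
  proof (rule ccontr)
    assume "\<not> ?thesis"
    then obtain v v' where v: "v \<in> ?V" "v \<in> P s" "v \<notin> ?B" and v': "v' \<in> ?V" "v' \<in> ?B" "v' \<notin> P s"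
      by blast
    have c: "v \<in> carrier R" "v' \<in> carrier R" using v v' V_carrier by auto
    have 1: "v' \<in> P (Suc s) - P s" "\<beta> \<otimes> v \<in> P (Suc s) - P s"
      using v v' B_iff c by (auto simp: W_def)
    have "\<beta> \<otimes> v' \<in> P s" using v' B_iff c by simp
    then have "\<beta> \<otimes> v' \<in> P (Suc s)" using P_mono[of s "Suc s"] by auto
    then have "v \<otimes> (\<beta> \<otimes> v') \<in> P (s + s)" using mult_P v(2) by blast
    moreover have "v \<otimes> (\<beta> \<otimes> v') = v' \<otimes> (\<beta> \<otimes> v)" using c \<beta> by (simp add: m_ac)
    moreover have "v' \<otimes> (\<beta> \<otimes> v) \<notin> P (s + s)"
      using mult_P_diff[OF 1] s by simp
    ultimately show False by simp
  qed
  then show ?thesis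
  proof
    assume "?V \<inter> P s \<subseteq> ?B"
    have "?V \<subseteq> line_extension K (lam [^] s) (P s)" unfolding P_Suc[symmetric] by (auto simp: W_def)
    then have "card ?V \<le> card K * card (?V \<inter> P s)"
      by (rule card_le_Int_hyperplane[OF V subspace_P pow_lam])
    also have "card (?V \<inter> P s) \<le> card (W s \<beta>)"
      using A \<open>?V \<inter> P s \<subseteq> ?B\<close> card_subspace_mono[OF subspace_W] \<beta> by blast
    finally show ?thesis by simp
  next
    assume *: "?V \<inter> ?B \<subseteq> P s"
    have "?V \<subseteq> line_extension K (inv \<beta> \<otimes> lam [^] s) ?B"
    proof
      fix v assume v: "v \<in> ?V"
      then obtain k u where ku: "k \<in> K" "u \<in> P s" "\<beta> \<otimes> v = k \<otimes> lam [^] s \<oplus> u"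
        using P_Suc_iff by (auto simp: W_def)
      have c: "k \<in> carrier R" "u \<in> carrier R" "inv \<beta> \<in> carrier R"
        using ku K_carrier P_carrier ib by auto
      have "v = inv \<beta> \<otimes> (\<beta> \<otimes> v)" using mult_inv_cancel(2)[OF \<beta>] V_carrier[OF v] by simp
      also have "\<dots> = k \<otimes> (inv \<beta> \<otimes> lam [^] s) \<oplus> inv \<beta> \<otimes> u"
        unfolding ku(3) using c pow_lam[of s] by algebra
      finally show "v \<in> line_extension K (inv \<beta> \<otimes> lam [^] s) ?B"
        using ku(1,2) line_extension_mem_iff unfolding smul_set_def by blast
    qed
    then have "card ?V \<le> card K * card (?V \<inter> ?B)"
      using ib by (intro card_le_Int_hyperplane[OF V subspace_smul_set[OF subspace_P]]) auto
    also have "card (?V \<inter> ?B) \<le> card (W s \<beta>)"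
      using B * card_subspace_mono[OF subspace_W] \<beta> by blast
    finally show ?thesis by simp
  qed
qed

text \<open>Multiplication by \<open>lam\<close> maps \<open>W s \<beta>\<close> into
  \<open>W (Suc s) \<beta>\<close>. If they agreed, \<open>W s \<beta>\<close> would be stable under
  \<open>lam\<close>, but a nonzero element of degree \<open>d < s\<close> reaches degree
  \<open>s\<close> after multiplication by \<open>lam [^] (s - d)\<close>.\<close>

lemma W_Suc_neq:
  assumes \<beta>: "\<beta> \<in> carrier R" and s: "s < t" and ne: "W s \<beta> \<noteq> {\<zero>}"
  shows "W s \<beta> \<noteq> W (Suc s) \<beta>"
proof
  assume eq: "W s \<beta> = W (Suc s) \<beta>"
  have step: "lam \<otimes> v \<in> W s \<beta>" if "v \<in> W s \<beta>" for v
  proof -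
    have "v \<in> carrier R" using that P_carrier by (auto simp: W_def)
    then have "\<beta> \<otimes> (lam \<otimes> v) = lam \<otimes> (\<beta> \<otimes> v)" using \<beta> lam by (simp add: m_ac)
    then have "lam \<otimes> v \<in> W (Suc s) \<beta>" using that lam_mult_P by (simp add: W_def)
    then show ?thesis using eq by simp
  qed
  have pow: "lam [^] i \<otimes> v \<in> P s" if "v \<in> W s \<beta>" for v and i :: nat
  proof -
    have "lam [^] i \<otimes> v \<in> W s \<beta>"
    proof (induction i)
      case 0
      have "v \<in> carrier R" using that P_carrier by (auto simp: W_def)
      then show ?case using that by simp
    next
      case (Suc i)
      have "v \<in> carrier R" using that P_carrier by (auto simp: W_def)
      then have "lam [^] Suc i \<otimes> v = lam \<otimes> (lam [^] i \<otimes> v)" using lam by (simp add: m_ac)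
      then show ?case using step Suc by simp
    qed
    then show ?thesis by (simp add: W_def)
  qed
  obtain v where v: "v \<in> W s \<beta>" "v \<noteq> \<zero>" using ne subspaceD(2)[OF subspace_W[OF \<beta>]] by blast
  then obtain d where d: "d < s" "v \<in> P (Suc d) - P d" using P_degree by (auto simp: W_def)
  have "lam [^] (s - d) \<in> P (Suc (s - d)) - P (s - d)"
    using pow_in_P pow_notin_P s by simp
  then have "lam [^] (s - d) \<otimes> v \<notin> P s"
    using mult_P_diff[of "lam [^] (s - d)" "s - d" v d] d s by simp
  then show False using pow v by blast
qed

lemma card_W_Suc:
  assumes \<beta>: "\<beta> \<in> Rx" and s: "2 * s < t" and ne: "W s \<beta> \<noteq> W (Suc s) \<beta>"
  shows "card (W (Suc s) \<beta>) = card K * card (W s \<beta>)"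
  using card_W_Suc_le[OF \<beta> s] card_strict_subspace[OF subspace_W subspace_W, of \<beta> \<beta> s "Suc s"]
    W_mono ne \<beta> by (intro antisym) auto

text \<open>For \<open>2 * i < t\<close>, the elements \<open>u / v\<close> with \<open>u\<close>, \<open>v\<close> coprime polynomials in \<open>lam\<close> of maximal degree \<open>i\<close>.\<close>

definition A :: "nat \<Rightarrow> 'a set" where
  "A i = {\<beta> \<in> Rx. card (W i \<beta>) = 1 \<and> card (W (Suc i) \<beta>) = card K}"

text \<open>Once nonzero, the space must grow at every step by \<open>W_Suc_neq\<close>, and
  \<open>card_W_Suc\<close> makes the growth exactly one dimension.\<close>

lemma card_W_A:
  assumes "\<beta> \<in> A i" and "2 * (i + d) < t"
  shows "card (W (i + Suc d) \<beta>) = card K ^ Suc d"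
  using assms(2)
proof (induction d)
  case 0
  then show ?case using assms(1) by (simp add: A_def)
next
  case (Suc d)
  have \<beta>: "\<beta> \<in> Rx" using assms(1) by (simp add: A_def)
  have "card (W (i + Suc d) \<beta>) = card K ^ Suc d" using Suc by simp
  moreover have "card K ^ Suc d > 1" using card_K_gt_1 by (intro one_less_power) auto
  ultimately have "W (i + Suc d) \<beta> \<noteq> {\<zero>}" using card_K_gt_1 by auto
  then have "W (i + Suc d) \<beta> \<noteq> W (Suc (i + Suc d)) \<beta>"
    using W_Suc_neq[of \<beta> "i + Suc d"] \<beta> Suc.prems by simp
  then have "card (W (Suc (i + Suc d)) \<beta>) = card K * card (W (i + Suc d) \<beta>)"
    using card_W_Suc[OF \<beta>, of "i + Suc d"] Suc.prems by simp
  then show ?case using Suc by simp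
qed

lemma card_W_A':
  assumes "\<beta> \<in> A i" and "i < s" and "2 * (s - 1) < t"
  shows "card (W s \<beta>) = card K ^ (s - i)"
proof -
  have "s = i + Suc (s - i - 1)" using assms(2) by simp
  moreover obtain d where "d = s - i - 1" by blast
  ultimately have d: "s = i + Suc d" by simp
  show ?thesis using card_W_A[OF assms(1), of d] assms(3) unfolding d by simp
qed

text \<open>The index sought is the last one at which \<open>W\<close> is still trivial; the first
  proper growth has factor exactly \<open>card K\<close>.\<close>

lemma in_A_if_card_W:
  assumes "\<beta> \<in> Rx" "card (W s \<beta>) \<noteq> 1" "2 * (s - 1) < t"
  shows "\<exists>i<s. \<beta> \<in> A i"
  using assms(2,3)
proof (induction s)
  case 0
  then show ?case using W_0[of \<beta>] assms(1) by simp
next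
  case (Suc s)
  show ?case
  proof (cases "card (W s \<beta>) = 1")
    case True
    then have "W s \<beta> \<noteq> W (Suc s) \<beta>" using Suc.prems by auto
    then have "\<beta> \<in> A s" using card_W_Suc[OF assms(1)] True Suc.prems assms(1) by (simp add: A_def)
    then show ?thesis by auto
  next
    case False
    moreover have "2 * (s - 1) < t" using Suc.prems(2) by simp
    ultimately obtain i where "i < s" "\<beta> \<in> A i" using Suc.IH by blast
    then show ?thesis using less_SucI by blast
  qed
qed

lemma A_disjoint:
  assumes "i < j" "2 * (j - 1) < t"
  shows "A i \<inter> A j = {}"
proof (rule ccontr)
  assume "A i \<inter> A j \<noteq> {}"
  then obtain \<beta> where \<beta>: "\<beta> \<in> A i" "\<beta> \<in> A j" by blast
  then have "card K ^ (j - i) = 1" using card_W_A'[OF \<beta>(1) assms] by (simp add: A_def)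
  then show False using assms(1) card_K_gt_1 by simp
qed

lemma A_eq_iff: "\<beta> \<in> A i \<Longrightarrow> \<beta> \<in> A j \<Longrightarrow> 2 * (max i j - 1) < t \<Longrightarrow> i = j"
  using A_disjoint[of i j] A_disjoint[of j i] by (cases i j rule: linorder_cases) (auto simp: max_def)

text \<open>The values \<open>card K ^ (s - i)\<close> for \<open>i < s\<close> are distinct and
  exceed one, so the size of \<open>W s \<beta>\<close> reveals the degree.\<close>

lemma card_W_eq_iff:
  assumes \<beta>: "\<beta> \<in> Rx" and "i < s" and s: "2 * (s - 1) < t"
  shows "card (W s \<beta>) = card K ^ (s - i) \<longleftrightarrow> \<beta> \<in> A i"
proof
  assume c: "card (W s \<beta>) = card K ^ (s - i)"
  have "card K ^ (s - i) > 1" using card_K_gt_1 assms by (intro one_less_power) auto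
  then have "card (W s \<beta>) \<noteq> 1" unfolding c by (rule less_imp_neq[THEN not_sym])
  then obtain j where j: "j < s" "\<beta> \<in> A j" using in_A_if_card_W[OF \<beta> _ s] by blast
  then have "card K ^ (s - i) = card K ^ (s - j)" using card_W_A'[OF j(2,1) s] c by simp
  then have "s - i = s - j" using card_K_gt_1 by simp
  then show "\<beta> \<in> A i" using j assms by (simp add: diff_right_commute) (metis diff_diff_cancel less_imp_le_nat)
qed (use card_W_A' assms in blast)

text \<open>A pair \<open>(v, u)\<close> of nonzero elements of \<open>P s\<close> has exactly one
  quotient \<open>u / v\<close>. Sorting the pairs by their quotient gives the left-hand
  side.\<close>

lemma sum_card_W:
  assumes "s \<le> t"
  shows "(\<Sum>\<beta>\<in>Rx. card (W s \<beta>) - 1) = (card K ^ s - 1)\<^sup>2"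
proof -
  let ?Q = "P s - {\<zero>}"
  let ?S = "Sigma Rx (\<lambda>\<beta>. W s \<beta> - {\<zero>})"
  let ?f = "\<lambda>(\<beta>, v). (v, \<beta> \<otimes> v)"
  have W0: "\<zero> \<in> W s \<beta>" if "\<beta> \<in> Rx" for \<beta> using that subspaceD(2)[OF subspace_W] by simp
  have Q: "?Q \<subseteq> Rx" using P_carrier by blast
  have im: "?f ` ?S = ?Q \<times> ?Q"
  proof
    show "?f ` ?S \<subseteq> ?Q \<times> ?Q" using P_carrier by (fastforce simp: W_def integral_iff)
    show "?Q \<times> ?Q \<subseteq> ?f ` ?S"
    proof
      fix z assume "z \<in> ?Q \<times> ?Q"
      then obtain v u where z: "z = (v, u)"
        and v: "v \<in> P s" "v \<noteq> \<zero>" and u: "u \<in> P s" "u \<noteq> \<zero>" by blast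
      have vx: "v \<in> Rx" "u \<in> Rx" using u v Q by auto
      have iv: "inv v \<in> Rx" using inv_nonzero[OF vx(1)] .
      define \<beta> where "\<beta> = inv v \<otimes> u"
      have \<beta>: "\<beta> \<in> Rx" using iv vx by (simp add: \<beta>_def integral_iff)
      have "\<beta> \<otimes> v = v \<otimes> (inv v \<otimes> u)" using iv vx by (simp add: \<beta>_def m_ac)
      then have bv: "\<beta> \<otimes> v = u" using mult_inv_cancel(1)[OF vx(1)] vx by simp
      then have "(\<beta>, v) \<in> ?S" using \<beta> u v by (simp add: W_def)
      then show "z \<in> ?f ` ?S" using bv z by force
    qed
  qed
  have inj: "inj_on ?f ?S"
  proof (rule inj_onI)
    fix x y assume xy: "x \<in> ?S" "y \<in> ?S" "?f x = ?f y"
    obtain \<beta> v where x: "x = (\<beta>, v)" by (cases x)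
    obtain \<beta>' v' where y: "y = (\<beta>', v')" by (cases y)
    have v: "v = v'" and eq: "\<beta> \<otimes> v = \<beta>' \<otimes> v" using xy(3) unfolding x y prod.case prod.inject by blast+
    have c: "\<beta> \<in> Rx" "\<beta>' \<in> Rx" "v \<in> P s" "v \<noteq> \<zero>"
      using xy(1,2) by (simp_all add: x y W_def)
    have "v \<in> carrier R" using c(3) P_carrier by blast
    then show "x = y" using m_rcancel[of v \<beta> \<beta>'] c eq v by (simp add: x y)
  qed
  have "card ?S = card (?Q \<times> ?Q)"
    using card_image[OF inj] unfolding im by (rule sym)
  also have "\<dots> = (card K ^ s - 1)\<^sup>2"
    using card_P[OF assms] subspaceD(2)[OF subspace_P]
    by (simp add: card_cartesian_product power2_eq_square)
  also have "card ?S = (\<Sum>\<beta>\<in>Rx. card (W s \<beta> - {\<zero>}))"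
    using finite_Rx finite_subspace[OF subspace_W] by (intro card_SigmaI) auto
  also have "\<dots> = (\<Sum>\<beta>\<in>Rx. card (W s \<beta>) - 1)"
    using W0 by (intro sum.cong) auto
  finally show ?thesis .
qed

text \<open>Regroups \<open>sum_card_W\<close> by degree. Scalars outside every \<open>A i\<close>
  with \<open>i < s\<close> have trivial \<open>W s\<close> and contribute zero.\<close>

lemma sum_card_A:
  assumes "2 * (s - 1) < t" "s \<le> t"
  shows "(\<Sum>i<s. int (card (A i)) * (int (card K) ^ (s - i) - 1)) = (int (card K) ^ s - 1)\<^sup>2"
proof -
  let ?g = "\<lambda>\<beta>. int (card (W s \<beta>)) - 1"
  have finA: "finite (A i)" for i using finite_Rx by (auto simp: A_def)
  have pos: "card (W s \<beta>) \<ge> 1" if "\<beta> \<in> Rx" for \<beta>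
    using card_subspace_pos[OF subspace_W, of \<beta> s] that by simp
  have K1: "card K ^ s \<ge> 1" using card_K_gt_1 by simp
  have "(int (card K) ^ s - 1)\<^sup>2 = int ((card K ^ s - 1)\<^sup>2)"
    using K1 by (simp add: of_nat_diff)
  also have "\<dots> = (\<Sum>\<beta>\<in>Rx. int (card (W s \<beta>) - 1))"
    using sum_card_W[OF assms(2)] by (simp only: of_nat_sum[symmetric])
  also have "\<dots> = (\<Sum>\<beta>\<in>Rx. ?g \<beta>)"
    using pos by (intro sum.cong) (auto simp: of_nat_diff)
  also have "\<dots> = (\<Sum>\<beta>\<in>(\<Union>i<s. A i). ?g \<beta>)"
  proof (rule sum.mono_neutral_right[OF finite_Rx])
    show "(\<Union>i<s. A i) \<subseteq> Rx" by (auto simp: A_def)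
    show "\<forall>\<beta>\<in>Rx - (\<Union>i<s. A i). ?g \<beta> = 0" using in_A_if_card_W[OF _ _ assms(1)] by force
  qed
  also have "\<dots> = (\<Sum>i<s. \<Sum>\<beta>\<in>A i. ?g \<beta>)"
  proof (rule sum.UNION_disjoint)
    show "\<forall>i\<in>{..<s}. \<forall>j\<in>{..<s}. i \<noteq> j \<longrightarrow> A i \<inter> A j = {}"
    proof (intro ballI impI)
      fix i j assume ij: "i \<in> {..<s}" "j \<in> {..<s}" "i \<noteq> j"
      then have "2 * (max i j - 1) < t" using assms(1) by (auto simp: max_def)
      then show "A i \<inter> A j = {}" using A_eq_iff ij(3) by blast
    qed
  qed (use finA in auto)
  also have "\<dots> = (\<Sum>i<s. \<Sum>\<beta>\<in>A i. int (card K) ^ (s - i) - 1)"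
    using card_W_A'[OF _ _ assms(1)] by (intro sum.cong) auto
  also have "\<dots> = (\<Sum>i<s. int (card (A i)) * (int (card K) ^ (s - i) - 1))" by simp
  finally show ?thesis by simp
qed

text \<open>The equations of \<open>sum_card_A\<close> for growing \<open>s\<close> form a
  triangular system with diagonal entry \<open>card K - 1\<close>, which is nonzero.
  \<open>degree_count\<close> solves the same system, so the two agree by induction.\<close>

lemma card_A:
  assumes "2 * s < t"
  shows "int (card (A s)) = degree_count (int (card K)) s"
  using assms
proof (induction s rule: less_induct)
  case (less s)
  let ?q = "int (card K)"
  have "(\<Sum>i<Suc s. int (card (A i)) * (?q ^ (Suc s - i) - 1))
      = (\<Sum>i<Suc s. degree_count ?q i * (?q ^ (Suc s - i) - 1))"
    using sum_card_A[of "Suc s"] less.prems sum_degree_count_weighted[of ?q s] by simp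
  moreover have "(\<Sum>i<s. int (card (A i)) * (?q ^ (Suc s - i) - 1))
      = (\<Sum>i<s. degree_count ?q i * (?q ^ (Suc s - i) - 1))"
    using less by (intro sum.cong) auto
  ultimately have "int (card (A s)) * (?q - 1) = degree_count ?q s * (?q - 1)" by simp
  then show ?case using card_K_gt_1 by simp
qed

lemma card_union_A:
  assumes "2 * s < t"
  shows "int (card (\<Union>i<Suc s. A i)) = int (card K) ^ (2 * s + 1) - 1"
proof -
  have "card (\<Union>i<Suc s. A i) = (\<Sum>i<Suc s. card (A i))"
  proof (rule card_UN_disjoint)
    show "\<forall>i\<in>{..<Suc s}. \<forall>j\<in>{..<Suc s}. i \<noteq> j \<longrightarrow> A i \<inter> A j = {}"
    proof (intro ballI impI)
      fix i j assume ij: "i \<in> {..<Suc s}" "j \<in> {..<Suc s}" "i \<noteq> j"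
      then have "2 * (max i j - 1) < t" using assms by (auto simp: max_def)
      then show "A i \<inter> A j = {}" using A_eq_iff ij(3) by blast
    qed
  qed (use finite_Rx in \<open>auto simp: A_def\<close>)
  then show ?thesis
    using card_A assms sum_degree_count[of "int (card K)" s]
    by (simp del: sum.lessThan_Suc add: sum.cong[of "{..<Suc s}" "{..<Suc s}" "\<lambda>i. int (card (A i))"])
qed

lemma W_trivial_iff_notin_A:
  assumes "\<beta> \<in> Rx" "2 * (s - 1) < t"
  shows "card (W s \<beta>) = 1 \<longleftrightarrow> \<beta> \<notin> (\<Union>i<s. A i)"
proof
  assume c: "card (W s \<beta>) = 1"
  show "\<beta> \<notin> (\<Union>i<s. A i)"
  proof
    assume "\<beta> \<in> (\<Union>i<s. A i)"
    then obtain i where i: "i < s" "\<beta> \<in> A i" by blast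
    then have "card K ^ (s - i) = 1" using card_W_A' c assms(2) by metis
    then show False using i card_K_gt_1 by simp
  qed
qed (use in_A_if_card_W assms in blast)

end

section \<open>The orbit code\<close>

text \<open>\<open>total\<close> is the form in which the condition on the span of \<open>S\<close>
  over \<open>F\<close> is used: the whole field is reached by replacing \<open>P m\<close> with
  \<open>F\<close> in the definition of \<open>S\<close>.\<close>

locale orbit_code = finite_simple_extension R K lam t for R (structure) and K lam t +
  fixes Sbar b m n
  assumes Sbar: "subalgebra F Sbar R" and b: "b \<in> Rx" and m: "0 < m" "m < t" "t < 2 * m"
    and direct: "Sbar \<inter> smul_set R b (P m) = {\<zero>}"
    and total: "carrier R = Sbar <+>\<^bsub>R\<^esub> smul_set R b F"
    and card_R: "card (carrier R) = card K ^ n"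
begin

definition S where "S = Sbar <+>\<^bsub>R\<^esub> smul_set R b (P m)"
definition H where "H = Sbar <+>\<^bsub>R\<^esub> smul_set R b (P (t - 1))"

abbreviation s where "s \<equiv> t - m"

lemma subspace_Sbar: "subspace Sbar"
  using subspace_if_F[OF Sbar] .

lemma Sbar_smult: "f \<in> F \<Longrightarrow> x \<in> Sbar \<Longrightarrow> f \<otimes> x \<in> Sbar"
  by (rule subalgebra.smult_closed[OF Sbar])

lemma Sbar_carrier: "Sbar \<subseteq> carrier R"
  using subspaceD(1)[OF subspace_Sbar] .

lemma b_carrier: "b \<in> carrier R"
  using b by simp

lemma subspace_bP: "subspace (smul_set R b (P j))"
  using subspace_smul_set[OF subspace_P b_carrier] .

lemma P_subset_F: "j \<le> t \<Longrightarrow> P j \<subseteq> F"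
  using P_mono P_t by blast

text \<open>For nonzero \<open>f\<close>, stability of \<open>Sbar\<close> under \<open>F\<close>
  would put \<open>b\<close> itself into \<open>Sbar\<close>. As \<open>0 < m\<close>,
  \<open>b\<close> also lies in \<open>b P m\<close>, against \<open>direct\<close>.\<close>

lemma direct_F:
  assumes "f \<in> F" "b \<otimes> f \<in> Sbar"
  shows "f = \<zero>"
proof (rule ccontr)
  assume f: "f \<noteq> \<zero>"
  have fc: "f \<in> Rx" using f assms(1) F_carrier by blast
  have "inv f \<in> F" using assms(1) f by (rule generate_field.m_inv)
  then have "inv f \<otimes> (b \<otimes> f) \<in> Sbar" using Sbar_smult assms(2) by blast
  moreover have "inv f \<otimes> (b \<otimes> f) = b"
    using mult_inv_cancel(2)[OF fc b_carrier] fc b_carrier by (simp add: m_comm)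
  ultimately have "b \<in> Sbar" by simp
  moreover have "b \<in> smul_set R b (P m)"
  proof -
    have "\<one> \<in> P m" using pow_in_P[OF m(1)] by simp
    then have "b \<otimes> \<one> \<in> smul_set R b (P m)" unfolding smul_set_def by blast
    then show ?thesis using b_carrier by simp
  qed
  ultimately show False using direct b by blast
qed

lemma total_iff: "x \<in> carrier R \<longleftrightarrow> (\<exists>a\<in>Sbar. \<exists>f\<in>F. x = a \<oplus> b \<otimes> f)"
  by (subst total) (auto simp: set_add_iff smul_set_def)

text \<open>By \<open>direct_F\<close> the decomposition into a part in \<open>Sbar\<close> and a
  part in \<open>b F\<close> is unique, so membership is decided by the second part alone.\<close>

lemma add_bP_iff:
  assumes "a \<in> Sbar" "f \<in> F" "j \<le> t"
  shows "a \<oplus> b \<otimes> f \<in> Sbar <+>\<^bsub>R\<^esub> smul_set R b (P j) \<longleftrightarrow> f \<in> P j"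
proof
  assume "a \<oplus> b \<otimes> f \<in> Sbar <+>\<^bsub>R\<^esub> smul_set R b (P j)"
  then obtain a' f' where *: "a' \<in> Sbar" "f' \<in> P j" "a \<oplus> b \<otimes> f = a' \<oplus> b \<otimes> f'"
    by (auto simp: set_add_iff smul_set_def)
  have f': "f' \<in> F" using * P_subset_F assms(3) by blast
  have c: "a \<in> carrier R" "a' \<in> carrier R" "f \<in> carrier R" "f' \<in> carrier R"
    using assms * f' Sbar_carrier F_carrier by auto
  have "b \<otimes> (f \<ominus> f') = (a \<oplus> b \<otimes> f) \<ominus> a \<ominus> b \<otimes> f'"
    using c b_carrier by algebra
  also have "\<dots> = a' \<ominus> a" unfolding *(3) using c b_carrier by algebra
  finally have "b \<otimes> (f \<ominus> f') \<in> Sbar" using subspaceD(6)[OF subspace_Sbar] * assms by simp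
  moreover have "f \<ominus> f' \<in> F" using subspaceD(6)[OF F_subspace] assms f' by blast
  ultimately have "f \<ominus> f' = \<zero>" using direct_F by blast
  then show "f \<in> P j" using * c by simp
next
  assume "f \<in> P j"
  then show "a \<oplus> b \<otimes> f \<in> Sbar <+>\<^bsub>R\<^esub> smul_set R b (P j)"
    using assms(1) unfolding set_add_iff smul_set_def by blast
qed

lemma subspace_S: "subspace S" and subspace_H: "subspace H"
  unfolding S_def H_def using subspace_add(1)[OF subspace_Sbar subspace_bP] by auto

text \<open>The form \<open>(v, x) \<mapsto> v x mod H\<close> takes the place of the trace form, so no dual bases are needed.\<close>

lemma S_iff:
  assumes "x \<in> carrier R"
  shows "x \<in> S \<longleftrightarrow> (\<forall>v\<in>P s. v \<otimes> x \<in> H)"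
proof -
  obtain a f where x: "a \<in> Sbar" "f \<in> F" "x = a \<oplus> b \<otimes> f"
    using assms total_iff by blast
  have c: "a \<in> carrier R" "f \<in> carrier R" using x Sbar_carrier F_carrier by auto
  have xS: "x \<in> S \<longleftrightarrow> f \<in> P m"
    unfolding S_def x(3) using add_bP_iff[OF x(1,2), of m] m by simp
  have vx: "v \<otimes> x \<in> H \<longleftrightarrow> v \<otimes> f \<in> P (t - 1)" if v: "v \<in> P s" for v
  proof -
    have vF: "v \<in> F" using v P_subset_F[of s] by auto
    have "v \<in> carrier R" using v P_carrier by auto
    then have "v \<otimes> x = v \<otimes> a \<oplus> b \<otimes> (v \<otimes> f)"
      unfolding x(3) using c b_carrier by algebra
    moreover have "v \<otimes> f \<in> F" using vF x(2) by (rule generate_field.eng_mult)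
    ultimately show ?thesis
      unfolding H_def using add_bP_iff[OF Sbar_smult[OF vF x(1)], of "v \<otimes> f" "t - 1"] by simp
  qed
  have "f \<in> P m \<longleftrightarrow> (\<forall>v\<in>P s. v \<otimes> f \<in> P (t - 1))"
  proof
    assume "f \<in> P m"
    then have "f \<in> P (Suc (m - 1))" using m by simp
    then have "v \<otimes> f \<in> P (s + (m - 1))" if "v \<in> P s" for v using mult_P that by blast
    moreover have "s + (m - 1) = t - 1" using m by simp
    ultimately show "\<forall>v\<in>P s. v \<otimes> f \<in> P (t - 1)" by simp
  next
    assume *: "\<forall>v\<in>P s. v \<otimes> f \<in> P (t - 1)"
    show "f \<in> P m"
    proof (rule ccontr)
      assume nf: "f \<notin> P m"
      then have "f \<noteq> \<zero>" using subspaceD(2)[OF subspace_P] by blast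
      moreover have "f \<in> P t" using x(2) P_t by simp
      ultimately obtain d where d: "d < t" "f \<in> P (Suc d) - P d" using P_degree by blast
      have md: "m \<le> d" using nf d P_mono[of "Suc d" m] by fastforce
      \<comment> \<open>This exponent lifts \<open>f\<close> to degree exactly \<open>t - 1\<close>,
        the one degree excluded by \<open>P (t - 1)\<close>. It is below \<open>s\<close> because
        \<open>m \<le> d\<close>.\<close>
      let ?e = "t - 1 - d"
      have "lam [^] ?e \<in> P (Suc ?e) - P ?e" using pow_in_P pow_notin_P d by simp
      then have "lam [^] ?e \<otimes> f \<in> P (Suc (?e + d)) - P (?e + d)"
        using d by (intro mult_P_diff) auto
      moreover have "lam [^] ?e \<in> P s" using md d by (intro pow_in_P) simp
      ultimately show False using * d by simp
    qed
  qed
  then show ?thesis using xS vx by blast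
qed

text \<open>An element lies in \<open>H\<close> iff the coefficient of
  \<open>lam [^] (t - 1)\<close> in its part from \<open>F\<close> vanishes, so \<open>H\<close> has
  codimension one.\<close>

lemma carrier_line_extension_H:
  "b \<otimes> lam [^] (t - 1) \<in> carrier R"
  "carrier R \<subseteq> line_extension K (b \<otimes> lam [^] (t - 1)) H"
  "\<not> carrier R \<subseteq> H"
proof -
  show w: "b \<otimes> lam [^] (t - 1) \<in> carrier R" using b_carrier by simp
  show "carrier R \<subseteq> line_extension K (b \<otimes> lam [^] (t - 1)) H"
  proof
    fix x assume "x \<in> carrier R"
    then obtain a f where x: "a \<in> Sbar" "f \<in> F" "x = a \<oplus> b \<otimes> f" using total_iff by blast
    then have "f \<in> P (Suc (t - 1))" using P_t t_pos by simp
    then obtain k p where f: "k \<in> K" "p \<in> P (t - 1)" "f = k \<otimes> lam [^] (t - 1) \<oplus> p"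
      using P_Suc_iff by blast
    have c: "a \<in> carrier R" "k \<in> carrier R" "p \<in> carrier R"
      using x f Sbar_carrier K_carrier P_carrier by auto
    have "x = k \<otimes> (b \<otimes> lam [^] (t - 1)) \<oplus> (a \<oplus> b \<otimes> p)"
      unfolding x(3) f(3) using c b_carrier pow_lam[of "t - 1"] by algebra
    moreover have "a \<oplus> b \<otimes> p \<in> H"
      unfolding H_def set_add_iff smul_set_def using x(1) f(2) by blast
    ultimately show "x \<in> line_extension K (b \<otimes> lam [^] (t - 1)) H"
      using f(1) line_extension_mem_iff by blast
  qed
  have "lam [^] (t - 1) \<in> F" using pow_in_P[of "t - 1" t] t_pos P_t by simp
  moreover have "lam [^] (t - 1) \<notin> P (t - 1)" using pow_notin_P t_pos by simp
  ultimately have "\<zero> \<oplus> b \<otimes> lam [^] (t - 1) \<notin> H"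
    unfolding H_def using add_bP_iff[OF subspaceD(2)[OF subspace_Sbar]] by simp
  then show "\<not> carrier R \<subseteq> H" using w by auto
qed

lemma card_R_H: "card (carrier R) = card K * card H"
proof -
  have "carrier R \<inter> H = H" using subspaceD(1)[OF subspace_H] by blast
  then show ?thesis
    using card_Int_hyperplane[OF subspace_carrier subspace_H carrier_line_extension_H] by simp
qed

section \<open>Orthogonals for the product modulo \<open>H\<close>\<close>

definition perp :: "'a set \<Rightarrow> 'a set" where
  "perp U = {x \<in> carrier R. \<forall>u\<in>U. u \<otimes> x \<in> H}"

text \<open>Multiplication by \<open>x\<close> identifies the set in question with the section of
  \<open>x U\<close> by \<open>H\<close>, and \<open>x U\<close> is not contained in
  \<open>H\<close>.\<close>

lemma card_mult_in_H:
  assumes U: "subspace U" and x: "x \<in> carrier R" "x \<notin> perp U"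
  shows "card K * card {u \<in> U. u \<otimes> x \<in> H} = card U"
proof -
  note Uc = subspaceD(1)[OF U]
  have x0: "x \<in> Rx" using x Uc subspaceD(2)[OF subspace_H] by (auto simp: perp_def subset_iff)
  let ?V = "smul_set R x U"
  have V: "subspace ?V" using subspace_smul_set[OF U x(1)] .
  obtain u where "u \<in> U" "u \<otimes> x \<notin> H" using x by (auto simp: perp_def)
  moreover have "u \<otimes> x = x \<otimes> u" using \<open>u \<in> U\<close> Uc x by (simp add: m_comm subsetD)
  ultimately have nV: "\<not> ?V \<subseteq> H" by (auto simp: smul_set_def)
  have "?V \<subseteq> line_extension K (b \<otimes> lam [^] (t - 1)) H"
    using subspaceD(1)[OF V] carrier_line_extension_H(2) by blast
  then have "card ?V = card K * card (?V \<inter> H)"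
    using card_Int_hyperplane[OF V subspace_H carrier_line_extension_H(1) _ nV] by blast
  moreover have "?V \<inter> H = smul_set R x {u \<in> U. u \<otimes> x \<in> H}"
    using Uc x by (auto simp: smul_set_def m_comm subsetD)
  moreover have "card \<dots> = card {u \<in> U. u \<otimes> x \<in> H}"
    using Uc by (intro card_smul_set[OF x0]) auto
  ultimately show ?thesis using card_smul_set[OF x0 Uc] by simp
qed

text \<open>Double counting of the pairs \<open>(x, u)\<close> with \<open>u x\<close> in
  \<open>H\<close>. For fixed \<open>x\<close> the count depends only on whether \<open>x\<close> is
  orthogonal to \<open>U\<close>, for fixed \<open>u\<close> only on whether \<open>u\<close> is
  zero.\<close>

lemma card_perp:
  assumes U: "subspace U"
  shows "card (perp U) * card U = card (carrier R)"
proof -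
  let ?q = "card K" and ?R = "carrier R"
  note Uc = subspaceD(1)[OF U]
  have finU: "finite U" using finite_subspace[OF U] .
  have pR: "perp U \<subseteq> ?R" by (auto simp: perp_def)
  have finp: "finite (perp U)" using pR fin finite_subset by blast
  have "(\<Sum>x\<in>?R. card {u \<in> U. u \<otimes> x \<in> H}) = (\<Sum>u\<in>U. card {x \<in> ?R. u \<otimes> x \<in> H})"
    using sum.swap[of "\<lambda>x u. if u \<otimes> x \<in> H then 1 else 0 :: nat" U ?R] fin finU
    by (simp add: sum.If_cases Int_def)
  \<comment> \<open>The factor \<open>?q\<close> clears the denominators, since a proper section by
    \<open>H\<close> has a \<open>?q\<close>-th of the elements.\<close>
  then have "(\<Sum>x\<in>?R. ?q * card {u \<in> U. u \<otimes> x \<in> H}) = (\<Sum>u\<in>U. ?q * card {x \<in> ?R. u \<otimes> x \<in> H})"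
    by (simp flip: sum_distrib_left)
  moreover have "(\<Sum>x\<in>?R. ?q * card {u \<in> U. u \<otimes> x \<in> H})
      = card (perp U) * (?q * card U) + (card ?R - card (perp U)) * card U"
  proof -
    have "(\<Sum>x\<in>?R. ?q * card {u \<in> U. u \<otimes> x \<in> H})
      = (\<Sum>x\<in>?R - perp U. ?q * card {u \<in> U. u \<otimes> x \<in> H})
        + (\<Sum>x\<in>perp U. ?q * card {u \<in> U. u \<otimes> x \<in> H})"
      by (rule sum.subset_diff[OF pR fin])
    moreover have "(\<Sum>x\<in>?R - perp U. ?q * card {u \<in> U. u \<otimes> x \<in> H}) = (\<Sum>x\<in>?R - perp U. card U)"
      using card_mult_in_H[OF U] by (intro sum.cong) auto
    moreover have "(\<Sum>x\<in>perp U. ?q * card {u \<in> U. u \<otimes> x \<in> H}) = (\<Sum>x\<in>perp U. ?q * card U)"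
    proof (rule sum.cong)
      fix x assume "x \<in> perp U"
      then have "{u \<in> U. u \<otimes> x \<in> H} = U" by (auto simp: perp_def)
      then show "?q * card {u \<in> U. u \<otimes> x \<in> H} = ?q * card U" by simp
    qed simp
    ultimately show ?thesis using finp pR by (simp add: card_Diff_subset)
  qed
  moreover have "(\<Sum>u\<in>U. ?q * card {x \<in> ?R. u \<otimes> x \<in> H}) = ?q * card ?R + (card U - 1) * card ?R"
  proof -
    have z: "\<zero> \<in> U" using subspaceD(2)[OF U] .
    have "{x \<in> ?R. \<zero> \<otimes> x \<in> H} = ?R" using subspaceD(2)[OF subspace_H] by auto
    \<comment> \<open>This is where nondegeneracy enters: for nonzero \<open>u\<close> the solutions
      form a multiple of \<open>H\<close>, of the same size as \<open>H\<close>.\<close>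
    moreover have "?q * card {x \<in> ?R. u \<otimes> x \<in> H} = card ?R" if u: "u \<in> U - {\<zero>}" for u
    proof -
      have uR: "u \<in> Rx" using u Uc by auto
      have "{x \<in> ?R. u \<otimes> x \<in> H} = smul_set R (inv u) H"
        using mem_smul_set_iff[OF inv_nonzero[OF uR] subspaceD(1)[OF subspace_H]] uR field_Units
        by auto
      then show ?thesis
        using card_smul_set[OF inv_nonzero[OF uR] subspaceD(1)[OF subspace_H]] card_R_H by simp
    qed
    ultimately show ?thesis using sum.remove[OF finU z, of "\<lambda>u. ?q * card {x \<in> ?R. u \<otimes> x \<in> H}"]
        finU z by simp
  qed
  ultimately have e: "card (perp U) * (?q * card U) + (card ?R - card (perp U)) * card U
      = ?q * card ?R + (card U - 1) * card ?R" by simp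
  have "card (perp U) \<le> card ?R" using card_mono[OF fin pR] .
  moreover have "card U \<ge> 1" using card_subspace_pos[OF U] by simp
  ultimately have "int (card (perp U)) * (int ?q * int (card U))
      + (int (card ?R) - int (card (perp U))) * int (card U)
      = int ?q * int (card ?R) + (int (card U) - 1) * int (card ?R)"
    using arg_cong[OF e, of int] by (simp add: of_nat_diff)
  then have "(int ?q - 1) * (int (card (perp U)) * int (card U)) = (int ?q - 1) * int (card ?R)"
    by (simp add: algebra_simps)
  then have "int (card (perp U)) * int (card U) = int (card ?R)"
    using card_K_gt_1 by simp
  then show ?thesis by (simp flip: of_nat_mult)
qed

lemma S_eq_perp: "S = perp (P s)"
  using S_iff subspaceD(1)[OF subspace_S] by (auto simp: perp_def)

lemma card_S: "card S * card K ^ s = card (carrier R)"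
  using card_perp[OF subspace_P, of s] card_P[of s] S_eq_perp by simp

lemma S_carrier: "S \<subseteq> carrier R"
  using subspaceD(1)[OF subspace_S] .

lemma perp_add:
  assumes U: "subspace U" and V: "subspace V"
  shows "perp (U <+>\<^bsub>R\<^esub> V) = perp U \<inter> perp V"
proof
  show "perp (U <+>\<^bsub>R\<^esub> V) \<subseteq> perp U \<inter> perp V"
    using subspace_add(2,3)[OF U V] by (auto simp: perp_def)
  show "perp U \<inter> perp V \<subseteq> perp (U <+>\<^bsub>R\<^esub> V)"
  proof
    fix x assume x: "x \<in> perp U \<inter> perp V"
    have "(u \<oplus> v) \<otimes> x \<in> H" if "u \<in> U" "v \<in> V" for u v
    proof -
      have "u \<in> carrier R" "v \<in> carrier R" "x \<in> carrier R"
        using that subspaceD(1)[OF U] subspaceD(1)[OF V] x by (auto simp: perp_def)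
      then have "(u \<oplus> v) \<otimes> x = u \<otimes> x \<oplus> v \<otimes> x" by (simp add: l_distr)
      then show ?thesis using x that subspaceD(3)[OF subspace_H] by (simp add: perp_def)
    qed
    then show "x \<in> perp (U <+>\<^bsub>R\<^esub> V)" using x by (auto simp: perp_def set_add_iff)
  qed
qed

text \<open>The form depends only on the product of its arguments, so multiplication by
  \<open>inv \<alpha>\<close> can be moved from one argument to the other.\<close>

lemma smul_S_eq_perp:
  assumes \<alpha>: "\<alpha> \<in> Rx"
  shows "smul_set R \<alpha> S = perp (smul_set R (inv \<alpha>) (P s))"
proof -
  have ia: "inv \<alpha> \<in> carrier R" using inv_nonzero[OF \<alpha>] by simp
  have "x \<in> smul_set R \<alpha> S \<longleftrightarrow> x \<in> perp (smul_set R (inv \<alpha>) (P s))" if x: "x \<in> carrier R" for x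
  proof -
    have "v \<otimes> (inv \<alpha> \<otimes> x) = (inv \<alpha> \<otimes> v) \<otimes> x" if "v \<in> P s" for v
    proof -
      have "v \<in> carrier R" using that P_carrier by blast
      then show ?thesis using ia x by (simp add: m_ac)
    qed
    then have "inv \<alpha> \<otimes> x \<in> S \<longleftrightarrow> (\<forall>v\<in>P s. (inv \<alpha> \<otimes> v) \<otimes> x \<in> H)"
      using S_iff[of "inv \<alpha> \<otimes> x"] ia x by simp
    then show ?thesis
      using mem_smul_set_iff[OF \<alpha> S_carrier] x by (auto simp: perp_def smul_set_def)
  qed
  moreover have "smul_set R \<alpha> S \<subseteq> carrier R"
    using subspaceD(1)[OF subspace_smul_set[OF subspace_S]] \<alpha> by simp
  ultimately show ?thesis by (auto simp: perp_def)
qed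

text \<open>The intersection is the orthogonal of the sum of \<open>P s\<close> and its multiple by
  \<open>inv \<alpha>\<close>, and these two meet in \<open>W s \<alpha>\<close>. In dimensions:
  \<open>n - 2 * s + dim K (W s \<alpha>)\<close>.\<close>

lemma card_S_Int:
  assumes \<alpha>: "\<alpha> \<in> Rx"
  shows "card (S \<inter> smul_set R \<alpha> S) * card K ^ (2 * s) = card (carrier R) * card (W s \<alpha>)"
proof -
  let ?Q = "smul_set R (inv \<alpha>) (P s)"
  have ia: "inv \<alpha> \<in> Rx" using inv_nonzero[OF \<alpha>] .
  have Q: "subspace ?Q" using subspace_smul_set[OF subspace_P] ia by simp
  have "S \<inter> smul_set R \<alpha> S = perp (P s <+>\<^bsub>R\<^esub> ?Q)"
    using S_eq_perp smul_S_eq_perp[OF \<alpha>] perp_add[OF subspace_P Q] by simp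
  then have 1: "card (S \<inter> smul_set R \<alpha> S) * card (P s <+>\<^bsub>R\<^esub> ?Q) = card (carrier R)"
    using card_perp[OF subspace_add(1)[OF subspace_P Q]] by simp
  have "P s \<inter> ?Q = W s \<alpha>"
    using mem_smul_set_iff[OF ia P_carrier] P_carrier \<alpha> field_Units by (auto simp: W_def)
  then have "card (P s <+>\<^bsub>R\<^esub> ?Q) * card (W s \<alpha>) = card (P s) * card ?Q"
    using card_subspace_add[OF subspace_P Q, of s] by simp
  also have "\<dots> = card K ^ (2 * s)"
    using card_smul_set[OF ia P_carrier] card_P[of s] by (simp add: mult_2 power_add)
  finally show ?thesis using 1 by (metis mult.assoc)
qed

section \<open>From intersections to weights\<close>

lemma t_le_n: "t \<le> n"
proof -
  have "card K ^ t \<le> card K ^ n"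
    using card_subspace_mono[OF subspace_carrier F_carrier] card_P[of t] P_t card_R by simp
  then show ?thesis using card_K_gt_1 by simp
qed

text \<open>\<open>n - s\<close> is the dimension of \<open>S\<close>. If \<open>w\<close> is the
  dimension of \<open>W s \<alpha>\<close>, the distance is
  \<open>2 * (n - s) - 2 * (n - 2 * s + w) = 2 * (s - w)\<close>; the bounds
  \<open>2 * s \<le> n\<close>, \<open>w \<le> s\<close> and \<open>i \<le> s\<close> keep all
  subtractions exact.\<close>

lemma sdist_eq_iff:
  assumes \<alpha>: "\<alpha> \<in> Rx" and i: "i \<le> s"
  shows "sdist R K (n - s) S (smul_set R \<alpha> S) = 2 * i \<longleftrightarrow> card (W s \<alpha>) = card K ^ (s - i)"
proof -
  let ?V = "S \<inter> smul_set R \<alpha> S"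
  have V: "subspace ?V" using subspace_Int[OF subspace_S subspace_smul_set[OF subspace_S]] \<alpha> by simp
  have w: "card (W s \<alpha>) = card K ^ dim K (W s \<alpha>)" using card_subspace[OF subspace_W] \<alpha> by simp
  have "card (W s \<alpha>) \<le> card (P s)"
    by (rule card_subspace_mono[OF subspace_P]) (auto simp: W_def)
  then have ws: "dim K (W s \<alpha>) \<le> s" using w card_P[of s] card_K_gt_1 by simp
  have "card K ^ (dim K ?V + 2 * s) = card K ^ (n + dim K (W s \<alpha>))"
    using card_S_Int[OF \<alpha>] card_subspace[OF V] w card_R by (simp add: power_add)
  then have "dim K ?V + 2 * s = n + dim K (W s \<alpha>)" using card_K_gt_1 by simp
  moreover have "2 * s \<le> n" using t_le_n m by simp
  ultimately have "sdist R K (n - s) S (smul_set R \<alpha> S) = 2 * (s - dim K (W s \<alpha>))"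
    using ws unfolding sdist_def by linarith
  moreover have "card (W s \<alpha>) = card K ^ (s - i) \<longleftrightarrow> dim K (W s \<alpha>) = s - i"
    unfolding w using card_K_gt_1 by simp
  moreover have "2 * (s - w) = 2 * i \<longleftrightarrow> w = s - i" if "w \<le> s" for w using that i by linarith
  ultimately show ?thesis using ws by simp
qed

text \<open>\<open>\<alpha>\<close> fixes \<open>S\<close> iff the intersection has full size, that
  is, iff \<open>W s \<alpha>\<close> is all of \<open>P s\<close>, which is degree zero. Thus
  \<open>A 0\<close> is the stabiliser of \<open>S\<close>.\<close>

lemma smul_S_eq_iff:
  assumes \<alpha>: "\<alpha> \<in> Rx"
  shows "smul_set R \<alpha> S = S \<longleftrightarrow> \<alpha> \<in> A 0"
proof -
  let ?V = "S \<inter> smul_set R \<alpha> S"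
  have c: "card (smul_set R \<alpha> S) = card S" using card_smul_set[OF \<alpha> S_carrier] .
  have f: "finite S" "finite (smul_set R \<alpha> S)"
    using finite_subspace[OF subspace_S] finite_subspace[OF subspace_smul_set[OF subspace_S]] \<alpha>
    by auto
  have "smul_set R \<alpha> S = S \<longleftrightarrow> card ?V = card S"
  proof
    assume e: "card ?V = card S"
    then have "?V = S" by (intro card_subset_eq[OF f(1)]) auto
    moreover have "?V = smul_set R \<alpha> S" using e c by (intro card_subset_eq[OF f(2)]) auto
    ultimately show "smul_set R \<alpha> S = S" by simp
  qed simp
  also have "\<dots> \<longleftrightarrow> card ?V * card K ^ (2 * s) = card S * card K ^ (2 * s)"
    using card_K_gt_1 by simp
  also have "\<dots> \<longleftrightarrow> card (carrier R) * card (W s \<alpha>) = card (carrier R) * card K ^ s"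
  proof -
    have "card S * card K ^ (2 * s) = card (carrier R) * card K ^ s"
      using card_S by (simp add: mult_2 power_add)
    then show ?thesis using card_S_Int[OF \<alpha>] by simp
  qed
  also have "\<dots> \<longleftrightarrow> card (W s \<alpha>) = card K ^ (s - 0)"
    using card_subspace_pos[OF subspace_carrier] by simp
  also have "\<dots> \<longleftrightarrow> \<alpha> \<in> A 0" using card_W_eq_iff[OF \<alpha>, of 0 s] m by simp
  finally show ?thesis .
qed

text \<open>The fibre is the coset of the stabiliser \<open>A 0\<close> through
  \<open>\<alpha>\<close>, and \<open>A 0\<close> has \<open>card K - 1\<close> elements.\<close>

lemma card_orbit_fibre:
  assumes \<alpha>: "\<alpha> \<in> Rx"
  shows "card {\<beta> \<in> Rx. smul_set R \<beta> S = smul_set R \<alpha> S} = card K - 1"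
proof -
  have ia: "inv \<alpha> \<in> Rx" using inv_nonzero[OF \<alpha>] .
  have U: "\<alpha> \<in> Units R" using \<alpha> field_Units by blast
  have "{\<beta> \<in> Rx. smul_set R \<beta> S = smul_set R \<alpha> S} = smul_set R \<alpha> (A 0)"
  proof (rule Set.set_eqI)
    fix \<beta>
    show "\<beta> \<in> {\<beta> \<in> Rx. smul_set R \<beta> S = smul_set R \<alpha> S} \<longleftrightarrow> \<beta> \<in> smul_set R \<alpha> (A 0)"
    proof (cases "\<beta> \<in> Rx")
      case True
      have g: "inv \<alpha> \<otimes> \<beta> \<in> Rx" using ia True by (simp add: integral_iff)
      have "smul_set R \<beta> S = smul_set R \<alpha> S \<longleftrightarrow> smul_set R (inv \<alpha> \<otimes> \<beta>) S = S"
      proof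
        assume e: "smul_set R \<beta> S = smul_set R \<alpha> S"
        have "smul_set R (inv \<alpha> \<otimes> \<beta>) S = smul_set R (inv \<alpha>) (smul_set R \<alpha> S)"
          using smul_set_smul_set[OF _ _ S_carrier, of "inv \<alpha>" \<beta>] ia True e by simp
        also have "\<dots> = S"
          using smul_set_smul_set[OF _ _ S_carrier, of "inv \<alpha>" \<alpha>] ia \<alpha> U smul_set_one[OF S_carrier]
          by simp
        finally show "smul_set R (inv \<alpha> \<otimes> \<beta>) S = S" .
      next
        assume e: "smul_set R (inv \<alpha> \<otimes> \<beta>) S = S"
        have "smul_set R \<alpha> S = smul_set R \<alpha> (smul_set R (inv \<alpha> \<otimes> \<beta>) S)" using e by simp
        also have "\<dots> = smul_set R \<beta> S"
          using smul_set_smul_set[OF _ _ S_carrier, of \<alpha> "inv \<alpha> \<otimes> \<beta>"] g \<alpha> True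
            mult_inv_cancel(1)[OF \<alpha>, of \<beta>] by simp
        finally show "smul_set R \<beta> S = smul_set R \<alpha> S" by simp
      qed
      also have "\<dots> \<longleftrightarrow> inv \<alpha> \<otimes> \<beta> \<in> A 0" using smul_S_eq_iff[OF g] .
      also have "\<dots> \<longleftrightarrow> \<beta> \<in> smul_set R \<alpha> (A 0)"
        using mem_smul_set_iff[OF \<alpha>, of "A 0" \<beta>] True by (auto simp: A_def)
      finally show ?thesis using True by simp
    next
      case False
      moreover have "smul_set R \<alpha> (A 0) \<subseteq> Rx"
        using \<alpha> by (auto simp: smul_set_def A_def) (metis integral)
      ultimately show ?thesis by blast
    qed
  qed
  moreover have "card (smul_set R \<alpha> (A 0)) = card (A 0)"
    by (rule card_smul_set[OF \<alpha>]) (auto simp: A_def)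
  moreover have "card (A 0) = card K - 1"
    using card_A[of 0] t_pos card_K_gt_1 by (simp add: degree_count_def)
  ultimately show ?thesis by simp
qed

lemma card_orbit:
  "card {\<alpha> \<in> Rx. Q (smul_set R \<alpha> S)} = (card K - 1) * card {V \<in> orb R S. Q V}"
proof -
  let ?O = "{V \<in> orb R S. Q V}"
  have O: "orb R S = (\<lambda>\<alpha>. smul_set R \<alpha> S) ` Rx" by (auto simp: orb_def)
  have "{\<alpha> \<in> Rx. Q (smul_set R \<alpha> S)} = (\<Union>V\<in>?O. {\<alpha> \<in> Rx. smul_set R \<alpha> S = V})"
    by (auto simp: O)
  also have "card \<dots> = (\<Sum>V\<in>?O. card {\<alpha> \<in> Rx. smul_set R \<alpha> S = V})"
    using finite_Rx by (intro card_UN_disjoint) (auto simp: O)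
  also have "\<dots> = (\<Sum>V\<in>?O. card K - 1)"
    using card_orbit_fibre by (intro sum.cong) (auto simp: O)
  finally show ?thesis by simp
qed

lemma weight_eq:
  assumes "i \<le> s"
  shows "(card K - 1) * weight R K (n - s) S i = card {\<alpha> \<in> Rx. card (W s \<alpha>) = card K ^ (s - i)}"
proof -
  have "(card K - 1) * weight R K (n - s) S i
      = card {\<alpha> \<in> Rx. sdist R K (n - s) S (smul_set R \<alpha> S) = 2 * i}"
    unfolding weight_def by (rule card_orbit[symmetric])
  also have "{\<alpha> \<in> Rx. sdist R K (n - s) S (smul_set R \<alpha> S) = 2 * i}
      = {\<alpha> \<in> Rx. card (W s \<alpha>) = card K ^ (s - i)}"
    using sdist_eq_iff[OF _ assms] by auto
  finally show ?thesis .
qed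

lemma weight_below:
  assumes "0 < i" "i < s"
  shows "weight R K (n - s) S i = (card K + 1) * card K ^ (2 * i - 1)"
proof -
  have "{\<alpha> \<in> Rx. card (W s \<alpha>) = card K ^ (s - i)} = A i"
    using card_W_eq_iff[of _ i s] assms m by (auto simp: A_def)
  then have "int ((card K - 1) * weight R K (n - s) S i) = degree_count (int (card K)) i"
    using weight_eq[of i] card_A[of i] assms m by simp
  \<comment> \<open>As \<open>0 < i\<close>, the second case of \<open>degree_count\<close> applies,
    and its factor \<open>q^2 - 1\<close> splits off the \<open>q - 1\<close> to be
    cancelled.\<close>
  then have "(int (card K) - 1) * int (weight R K (n - s) S i)
      = (int (card K) - 1) * ((int (card K) + 1) * int (card K) ^ (2 * i - 1))"
    using assms card_K_gt_1 by (simp add: degree_count_def of_nat_diff algebra_simps power2_eq_square)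
  then have "int (weight R K (n - s) S i) = (int (card K) + 1) * int (card K) ^ (2 * i - 1)"
    using card_K_gt_1 by simp
  then have "int (weight R K (n - s) S i) = int ((card K + 1) * card K ^ (2 * i - 1))"
    by (simp add: algebra_simps)
  then show ?thesis by (simp only: of_nat_eq_iff)
qed

text \<open>Maximal distance means trivial \<open>W s \<alpha>\<close>, so the scalars to count are
  the complement of those of degree below \<open>s\<close>. The two subtracted ones, for zero and in
  \<open>card_union_A\<close>, cancel.\<close>

lemma weight_top:
  "(int (card K) - 1) * int (weight R K (n - s) S s) = int (card K) ^ n - int (card K) ^ (2 * s - 1)"
proof -
  let ?U = "\<Union>i<s. A i"
  have U: "?U \<subseteq> Rx" by (auto simp: A_def)
  have "{\<alpha> \<in> Rx. card (W s \<alpha>) = card K ^ (s - s)} = Rx - ?U"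
    using W_trivial_iff_notin_A[of _ s] m by auto
  then have "(card K - 1) * weight R K (n - s) S s = card (Rx - ?U)" using weight_eq[of s] by simp
  also have "\<dots> = card Rx - card ?U"
    using finite_subset[OF U finite_Rx] U by (intro card_Diff_subset)
  finally have "int ((card K - 1) * weight R K (n - s) S s) = int (card Rx) - int (card ?U)"
    using of_nat_diff[OF card_mono[OF finite_Rx U]] by metis
  moreover have "int (card ?U) = int (card K) ^ (2 * s - 1) - 1"
  proof -
    \<comment> \<open>\<open>card_union_A\<close> ranges over degrees up to and including its
      argument; \<open>m < t\<close> makes \<open>s\<close> positive.\<close>
    have "s = Suc (s - 1)" "2 * s - 1 = 2 * (s - 1) + 1" using m by auto
    then show ?thesis using card_union_A[of "s - 1"] m by simp
  qed
  moreover have "int (card Rx) = int (card K) ^ n - 1"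
  proof -
    have "card K ^ n \<ge> 1" using card_K_gt_1 by simp
    then show ?thesis using card_R by (simp add: of_nat_diff)
  qed
  ultimately show ?thesis using card_K_gt_1 by (simp add: of_nat_diff)
qed

end

section \<open>Translation to the notions of the theorem\<close>

lemma (in finite_simple_extension) F_eq_Fsub: "F = Fsub R (card K ^ t)"
proof -
  have cF: "card F = card K ^ t" using card_P[of t] P_t by simp
  have "card K ^ t > 1" using card_K_gt_1 t_pos by (intro one_less_power) auto
  then have le: "card (Fsub R (card K ^ t)) \<le> card F" using card_Fsub_le[OF fin] cF by simp
  \<comment> \<open>Elements of the field \<open>F\<close> satisfy \<open>x [^] card F = x\<close>.
    Equality follows since the power map has at most \<open>card K ^ t\<close> fixed points.\<close>
  have "F \<subseteq> Fsub R (card K ^ t)"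
  proof
    fix x assume x: "x \<in> F"
    interpret F: field "R \<lparr>carrier := F\<rparr>" using subfield_iff(2)[OF subfield_F] .
    have "x [^]\<^bsub>R \<lparr>carrier := F\<rparr>\<^esub> card F = x"
      using F.pow_card_eq x finite_subspace[OF F_subspace] by simp
    then have "x [^] card F = x" by (simp add: nat_pow_consistent[symmetric])
    then show "x \<in> Fsub R (card K ^ t)" using x F_carrier cF by (auto simp: Fsub_def)
  qed
  moreover have "finite (Fsub R (card K ^ t))" using fin by (simp add: Fsub_def)
  ultimately show ?thesis using le by (simp add: card_seteq)
qed

text \<open>Compares the sizes in the direct decomposition into \<open>Sbar\<close> and
  \<open>b F\<close>, where \<open>Sbar\<close> is measured over \<open>F\<close>. This is what
  turns \<open>k = t * l + m\<close> into \<open>n - s\<close>.\<close>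

lemma (in orbit_code) n_eq:
  "n = t * dim F Sbar + t"
proof -
  interpret F: finite_field_over R F
    by (intro finite_field_over.intro finite_field_over_axioms.intro field_axioms fin subfield_F)
  have "Sbar \<inter> smul_set R b F = {\<zero>}"
  proof
    show "Sbar \<inter> smul_set R b F \<subseteq> {\<zero>}"
    proof
      fix x assume x: "x \<in> Sbar \<inter> smul_set R b F"
      then obtain f where f: "f \<in> F" "x = b \<otimes> f" by (auto simp: smul_set_def)
      then have "f = \<zero>" using direct_F x by blast
      then show "x \<in> {\<zero>}" using f b_carrier by simp
    qed
    show "{\<zero>} \<subseteq> Sbar \<inter> smul_set R b F"
      using subspaceD(2)[OF subspace_Sbar] subspaceD(2)[OF subspace_bP[of t]] P_t by simp
  qed
  then have "card (carrier R) = card Sbar * card (smul_set R b F)"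
    using card_subspace_add[OF subspace_Sbar subspace_bP[of t]] total P_t by simp
  also have "card (smul_set R b F) = card K ^ t"
    using card_smul_set[OF b F_carrier] card_P[of t] P_t by simp
  also have "card Sbar = card K ^ (t * dim F Sbar)"
    using F.card_subspace[OF Sbar] card_P[of t] P_t by (simp add: power_mult)
  finally have "card K ^ n = card K ^ (t * dim F Sbar + t)" using card_R by (simp add: power_add)
  then show ?thesis using card_K_gt_1 by simp
qed

theorem theorem4p12:
  fixes R :: "('a, 'b) ring_scheme" and q n t l m k r :: nat and lam b :: 'a and Sbar S :: "'a set"
  assumes field: "field R" and fin: "finite (carrier R)"
    and qpp: "\<exists>p e. Factorial_Ring.prime (p::nat) \<and> e > 0 \<and> q = p ^ e"
    and card: "card (carrier R) = q ^ n"
    and lam: "lam \<in> carrier R - Fsub R q"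
    and t_def: "t = ring.dim R (Fsub R q) (generate_field R (insert lam (Fsub R q)))"
    and Sbar_sub: "subalgebra (Fsub R (q ^ t)) Sbar R"
    and Sbar_dim: "ring.dim R (Fsub R (q ^ t)) Sbar = l" and l_pos: "l > 0"
    and b: "b \<in> carrier R - {\<zero>\<^bsub>R\<^esub>}"
    and b_cap: "Fsub R (q ^ t) \<inter> smul_set R b Sbar = {\<zero>\<^bsub>R\<^esub>}"
    and m: "0 < m" "m < t"
    and k_def: "k = t * l + m" and k_bounds: "t + 1 \<le> k" "k \<le> n"
    and S_def: "S = Sbar <+>\<^bsub>R\<^esub> smul_set R b (ring.Span R (Fsub R q) (map (\<lambda>i. lam [^]\<^bsub>R\<^esub> i) [0..<m]))"
    and direct: "Sbar \<inter> smul_set R b (ring.Span R (Fsub R q) (map (\<lambda>i. lam [^]\<^bsub>R\<^esub> i) [0..<m])) = {\<zero>\<^bsub>R\<^esub>}"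
    and Y: "span_set R (Fsub R (q ^ t)) S = carrier R"
    and m2: "2 * m > t"
    and r_def: "r = 2 * m + t * (l - 1)"
    and FWS: "is_FWS R (Fsub R q) k S r"
  shows "(\<forall>i \<in> {1..t - m - 1}. weight R (Fsub R q) k S i = (q + 1) * q ^ (2 * i - 1))
       \<and> real (weight R (Fsub R q) k S (t - m))
           = (real q ^ n - real q ^ (2 * (t - m) - 1)) / (real q - 1)"
proof -
  interpret R: field R by (rule field)
  define K where "K = Fsub R q"
  obtain p e where p: "Factorial_Ring.prime (p::nat)" "e > 0" "q = p ^ e" using qpp by blast
  have q: "q > 1" unfolding p(3) using prime_gt_1_nat[OF p(1)] p(2) by (rule one_less_power)
  have cK: "card K = q" unfolding K_def using R.card_Fsub[OF fin card q] .
  have "subfield K R" unfolding K_def p(3) using R.subfield_Fsub[OF fin card[unfolded p(3)] p(1)] .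
  then interpret X: finite_simple_extension R K lam t
    using fin lam t_def
    by (intro finite_simple_extension.intro finite_simple_extension_axioms.intro
        finite_field_over.intro finite_field_over_axioms.intro field) (auto simp: K_def)
  have F: "Fsub R (q ^ t) = X.F" using X.F_eq_Fsub cK by simp
  have P: "R.Span (Fsub R q) (map (\<lambda>i. lam [^]\<^bsub>R\<^esub> i) [0..<m]) = X.P m"
    unfolding X.P_def unfolding K_def ..
  interpret F: finite_field_over R X.F
    by (intro finite_field_over.intro finite_field_over_axioms.intro field fin X.subfield_F)
  have Sb: "subalgebra X.F Sbar R" using Sbar_sub F by simp
  have bF: "subalgebra X.F (smul_set R b X.F) R"
  proof (rule F.subspace_smul_set)
    show "subalgebra X.F X.F R"
      using R.finite_dimension_imp_subalgebra[OF X.subfield_F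
          R.finite_dimensionI[OF R.dimension_one[OF X.subfield_F]]] .
    show "b \<in> carrier R" using b by blast
  qed
  \<comment> \<open>The right-hand side is a subspace over \<open>F\<close> containing
    \<open>S\<close>, hence contains its span over \<open>F\<close>, which is everything.\<close>
  have total: "carrier R = Sbar <+>\<^bsub>R\<^esub> smul_set R b X.F"
  proof
    have "X.P m \<subseteq> X.F" using X.P_mono[of m t] X.P_t m by simp
    then have "S \<subseteq> Sbar <+>\<^bsub>R\<^esub> smul_set R b X.F"
      unfolding S_def P smul_set_def set_add_def' by blast
    then have "span_set R X.F S \<subseteq> Sbar <+>\<^bsub>R\<^esub> smul_set R b X.F"
      using F.subspace_add(1)[OF Sb bF] by (auto simp: span_set_def)
    then show "carrier R \<subseteq> Sbar <+>\<^bsub>R\<^esub> smul_set R b X.F" using Y F by simp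
    show "Sbar <+>\<^bsub>R\<^esub> smul_set R b X.F \<subseteq> carrier R"
      using F.subspaceD(1)[OF F.subspace_add(1)[OF Sb bF]] .
  qed
  interpret C: orbit_code R K lam t Sbar b m n
  proof (intro orbit_code.intro orbit_code_axioms.intro)
    show "finite_simple_extension R K lam t" by (rule X.finite_simple_extension_axioms)
    show "Sbar \<inter> smul_set R b (X.P m) = {\<zero>\<^bsub>R\<^esub>}" using direct unfolding P .
    show "card (carrier R) = card K ^ n" unfolding cK by (rule card)
  qed (fact Sb b m m2 total)+
  have S: "S = C.S" unfolding S_def C.S_def P ..
  have "R.dim X.F Sbar = l" using Sbar_dim F by simp
  then have k: "k = n - (t - m)" using C.n_eq k_def m by simp
  have "weight R (Fsub R q) k S i = (q + 1) * q ^ (2 * i - 1)" if "i \<in> {1..t - m - 1}" for i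
    using C.weight_below[of i] that cK unfolding S k K_def by auto
  moreover have "real (weight R (Fsub R q) k S (t - m))
           = (real q ^ n - real q ^ (2 * (t - m) - 1)) / (real q - 1)"
  proof -
    \<comment> \<open>The last weight is stated as a quotient, so the integer identity is carried to
      the reals, where \<open>q > 1\<close> permits the division.\<close>
    have "real_of_int ((int q - 1) * int (weight R (Fsub R q) k S (t - m)))
        = real_of_int (int q ^ n - int q ^ (2 * (t - m) - 1))"
      using C.weight_top cK unfolding S k K_def by simp
    then show ?thesis using q by (simp add: field_simps)
  qed
  ultimately show ?thesis by blast
qed

end
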